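(* Let $\mathscr{D}$ be an admissible operator with spectral growth order $p>1$. Let $n\ge 1$ and $r_i\ge 1$ for $i=1,\dots,n$ be integers. Let $w_{ij}\in\mathbb{R}$ be weights and $u_{ij}\in\mathbb{S}^2$ be pairwise distinct positions, for $i=1,\dots,n$ and $j=1,\dots,r_i$. Fix $\eta>0$. Then the optimization problem $$\min_{f\in\mathcal{H}_p}\ \frac{4\pi}{n}\sum_{i=1}^n\frac1{r_i}\sum_{j=1}^{r_i}(w_{ij}-f(u_{ij}))^2+\eta\,\|\mathscr{D}f\|_{L^2(\mathbb{S}^2)}^2$$ has a unique solution $\mu_\eta\in\mathcal{H}_p$, which is given by $$\mu_\eta=\sum_{i=1}^n\frac1{\sqrt{r_i}}\sum_{j=1}^{r_i}\alpha_{ij}\,\psi_{\mathscr{D}^*\mathscr{D}}(\langle\cdot,u_{ij}\rangle)$$ for some real coefficients $(\alpha_{ij})_{1\le i\le n,\,1\le j\le r_i}$, where $\psi_{\mathscr{D}^*\mathscr{D}}$ is the zonal Green's kernel of $\mathscr{D}^*\mathscr{D}$. Moreover, the coefficients are computed as follows. Let $L=\sum_{i=1}^n r_i$, and fix an enumeration (vectorization) of the pairs $(i,j)$, $1\le i\le n$, $1\le j\le r_i$, by indices $\ell\in\{1,\dots,L\}$. Let $\boldsymbol{\alpha}\in\mathbb{R}^L$ be the vectorized version of $(\alpha_{ij})$, let $\boldsymbol{y}\in\mathbb{R}^L$ be the vectorized version of $(w_{ij}/\sqrt{r_i})$, and let $\mathbf{G}\in\mathbb{R}^{L\times L}$ be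 the matrix with entries $$G_{\ell_1\ell_2}=\frac{\psi_{\mathscr{D}^*\mathscr{D}}(\langle u_{i_1j_1},u_{i_2j_2}\rangle)}{\sqrt{r_{i_1}r_{i_2}}},$$ where $\ell_1$ (resp. $\ell_2$) corresponds to $(i_1,j_1)$ (resp. $(i_2,j_2)$). Then $$\boldsymbol{\alpha}=\Big(\mathbf{G}+\frac{\eta n}{4\pi}\mathbf{I}_L\Big)^{-1}\boldsymbol{y},$$ where $\mathbf{I}_L$ is the $L\times L$ identity matrix.
   Context: $\mathbb{S}^2\subset\mathbb{R}^3$ is the unit sphere with surface measure (total mass $4\pi$), $\langle u,v\rangle$ for $u,v\in\mathbb{S}^2$ is the Euclidean inner product, and $\{Y_{\ell,m}\}_{\ell\in\mathbb{N},-\ell\le m\le\ell}$ is a standard real orthonormal basis of spherical harmonics of $L^2(\mathbb{S}^2)$ (real-valued functions). For $p\ge0$, $\mathcal{H}_p=\{f\in L^2(\mathbb{S}^2):\|f\|_{\mathcal{H}_p}^2=\sum_{\ell\ge0}(1+\ell(\ell+1))^p\sum_{m=-\ell}^{\ell}\langle f,Y_{\ell,m}\rangle_{L^2(\mathbb S^2)}^2<\infty\}$. For $p>1$ elements of $\mathcal{H}_p$ are identified with their continuous representatives, so point values are defined. An admissible operator $\mathscr{D}$ with spectral growth order $p\ge 0$ is a linear operator $\mathscr{D}f=\sum_{\ell\ge0}D_\ell\sum_{m=-\ell}^{\ell}\langle f,Y_{\ell,m}\rangle_{L^2(\mathbb S^2)}\,Y_{\ell,m}$ on smooth functions $f$,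 where $(D_\ell)_{\ell\in\mathbb{N}}$ are non-zero real numbers with $C_1(1+\ell)^p\le|D_\ell|\le C_2(1+\ell)^p$ for all $\ell\in\mathbb{N}$ and some constants $C_1,C_2>0$. It extends by the same formula to $\mathcal{H}_p\to L^2(\mathbb{S}^2)$, and its inverse (multiplication of the Fourier coefficients by $1/D_\ell$) extends to distributions. The operator $\mathscr{D}^*\mathscr{D}$ is the admissible operator with coefficients $D_\ell^2$. For an admissible operator $\mathscr{E}$ and $u\in\mathbb{S}^2$, the Green's function of $\mathscr{E}$ at $u$ is $\Psi^{\mathscr{E}}_u=\mathscr{E}^{-1}\delta_u$ ($\delta_u$ the Dirac distribution at $u$); the zonal Green's kernel of $\mathscr{E}$ is the function $\psi_{\mathscr{E}}:[-1,1]\to\mathbb{R}$ such that $\Psi^{\mathscr{E}}_u(v)=\psi_{\mathscr{E}}(\langle u,v\rangle)$ for all $u,v\in\mathbb{S}^2$. *)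

theory Defs
  imports "HOL-Analysis.Analysis" "Jordan_Normal_Form.Matrix"
begin

text \<open>
  Functions on the sphere are functions on \<open>\<real>\<^sup>3\<close> of which only the values on \<open>S2\<close> matter; where equality of
  functions matters they are taken to be \<open>extensional\<close>, i.e. arbitrary but fixed off \<open>S2\<close>.
\<close>

abbreviation S2 :: "(real^3) set" where
  "S2 \<equiv> sphere 0 1"

text \<open>
  Surface measure: the area of \<open>A\<close> is three times the volume of the solid cone
  \<open>{t x | 0 < t < 1, x \<in> A}\<close>. The total mass is \<open>3 \<sqdot> 4\<pi>/3 = 4\<pi>\<close>.
\<close>

definition surface_measure :: "(real^3) measure" where
  "surface_measure =
     scale_measure 3 (distr (restrict_space lborel (ball 0 1 - {0})) (restrict_space borel S2)
                            (\<lambda>x. x /\<^sub>R norm x))"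

definition square_integrable :: "(real^3 \<Rightarrow> real) \<Rightarrow> bool" where
  "square_integrable f \<longleftrightarrow>
     f \<in> borel_measurable surface_measure \<and> integrable surface_measure (\<lambda>x. (f x)\<^sup>2)"

definition l2_inner :: "(real^3 \<Rightarrow> real) \<Rightarrow> (real^3 \<Rightarrow> real) \<Rightarrow> real" where
  "l2_inner f g = integral\<^sup>L surface_measure (\<lambda>x. f x * g x)"

definition l2_norm :: "(real^3 \<Rightarrow> real) \<Rightarrow> real" where
  "l2_norm f = sqrt (l2_inner f f)"

definition laplacian :: "(real^3 \<Rightarrow> real) \<Rightarrow> real^3 \<Rightarrow> real" where
  "laplacian f x =
     (\<Sum>b\<in>Basis. frechet_derivative (\<lambda>y. frechet_derivative f (at y) b) (at x) b)"

text \<open>Restrictions to the sphere of harmonic homogeneous polynomials of degree \<open>l\<close>.\<close>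

definition spherical_harmonic :: "nat \<Rightarrow> (real^3 \<Rightarrow> real) \<Rightarrow> bool" where
  "spherical_harmonic l f \<longleftrightarrow>
     (\<exists>P. real_polynomial_function P \<and> (\<forall>c x. P (c *\<^sub>R x) = c ^ l * P x) \<and>
          (\<forall>x. laplacian P x = 0) \<and> (\<forall>x\<in>S2. f x = P x))"

type_synonym sph_family = "nat \<Rightarrow> int \<Rightarrow> real^3 \<Rightarrow> real"

definition sph_partial_sum :: "sph_family \<Rightarrow> (nat \<Rightarrow> real) \<Rightarrow> (real^3 \<Rightarrow> real) \<Rightarrow> nat \<Rightarrow> real^3 \<Rightarrow> real" where
  "sph_partial_sum Y D f N x =
     (\<Sum>l<N. D l * (\<Sum>m\<in>{- int l..int l}. l2_inner f (Y l m) * Y l m x))"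

text \<open>
  For every degree \<open>l\<close> the \<open>Y l m\<close>, \<open>\<bar>m\<bar> \<le> l\<close>, are a basis of the spherical harmonics of degree \<open>l\<close>, and
  the whole family is an orthonormal basis of \<open>L\<^sup>2\<close>. The values \<open>Y l m\<close> for \<open>\<bar>m\<bar> > l\<close> are never used.
\<close>

definition spherical_harmonic_basis :: "sph_family \<Rightarrow> bool" where
  "spherical_harmonic_basis Y \<longleftrightarrow>
     (\<forall>l. \<forall>m\<in>{- int l..int l}. spherical_harmonic l (Y l m)) \<and>
     (\<forall>l f. spherical_harmonic l f \<longrightarrow>
        (\<exists>c. \<forall>x\<in>S2. f x = (\<Sum>m\<in>{- int l..int l}. c m * Y l m x))) \<and>
     (\<forall>l l'. \<forall>m\<in>{- int l..int l}. \<forall>m'\<in>{- int l'..int l'}.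
        l2_inner (Y l m) (Y l' m') = (if l = l' \<and> m = m' then 1 else 0)) \<and>
     (\<forall>f. square_integrable f \<longrightarrow>
        (\<lambda>N. l2_norm (\<lambda>x. f x - sph_partial_sum Y (\<lambda>_. 1) f N x)) \<longlonglongrightarrow> 0)"

definition sobolev :: "sph_family \<Rightarrow> real \<Rightarrow> (real^3 \<Rightarrow> real) set" where
  "sobolev Y p =
     {f. square_integrable f \<and>
         summable (\<lambda>l. (1 + real l * (real l + 1)) powr p *
                       (\<Sum>m\<in>{- int l..int l}. (l2_inner f (Y l m))\<^sup>2))}"

text \<open>For \<open>p > 1\<close>: the elements of \<open>sobolev Y p\<close>, identified with their continuous representatives.\<close>

definition sobolev_cont :: "sph_family \<Rightarrow> real \<Rightarrow> (real^3 \<Rightarrow> real) set" where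
  "sobolev_cont Y p = {f \<in> sobolev Y p. continuous_on S2 f \<and> f \<in> extensional S2}"

text \<open>An admissible operator is represented by its sequence of spectral coefficients.\<close>

definition admissible :: "real \<Rightarrow> (nat \<Rightarrow> real) \<Rightarrow> bool" where
  "admissible p D \<longleftrightarrow>
     p \<ge> 0 \<and> (\<forall>l. D l \<noteq> 0) \<and>
     (\<exists>C1>0. \<exists>C2>0. \<forall>l. C1 * (1 + real l) powr p \<le> \<bar>D l\<bar> \<and> \<bar>D l\<bar> \<le> C2 * (1 + real l) powr p)"

text \<open>The \<open>L\<^sup>2\<close> limit of the defining series; unique up to null sets.\<close>

definition sph_op :: "sph_family \<Rightarrow> (nat \<Rightarrow> real) \<Rightarrow> (real^3 \<Rightarrow> real) \<Rightarrow> real^3 \<Rightarrow> real" where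
  "sph_op Y D f =
     (SOME g. square_integrable g \<and>
              (\<lambda>N. l2_norm (\<lambda>x. g x - sph_partial_sum Y D f N x)) \<longlonglongrightarrow> 0)"

text \<open>
  Test functions on the sphere are the restrictions of \<open>C\<^sup>\<infinity>\<close> functions on \<open>\<real>\<^sup>3\<close>; distributions are
  functionals on test functions.
\<close>

primrec C_diff :: "nat \<Rightarrow> (real^3 \<Rightarrow> real) \<Rightarrow> bool" where
  "C_diff 0 f \<longleftrightarrow> continuous_on UNIV f"
| "C_diff (Suc k) f \<longleftrightarrow>
     f differentiable_on UNIV \<and> (\<forall>b\<in>Basis. C_diff k (\<lambda>x. frechet_derivative f (at x) b))"

definition smooth_on_S2 :: "(real^3 \<Rightarrow> real) \<Rightarrow> bool" where
  "smooth_on_S2 \<phi> \<longleftrightarrow> (\<exists>g. (\<forall>k. C_diff k g) \<and> (\<forall>x\<in>S2. \<phi> x = g x))"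

type_synonym sph_distribution = "(real^3 \<Rightarrow> real) \<Rightarrow> real"

definition dirac :: "real^3 \<Rightarrow> sph_distribution" where
  "dirac u \<phi> = \<phi> u"

text \<open>
  The Fourier coefficients of a distribution \<open>T\<close> are \<open>T (Y l m)\<close>. Its image under the inverse operator is
  \<open>\<Sum>\<^sub>l (1 / E l) \<Sum>\<^sub>m T (Y l m) Y l m\<close>, acting on a test function \<open>\<phi>\<close> term by term.
\<close>

definition sph_op_inv :: "sph_family \<Rightarrow> (nat \<Rightarrow> real) \<Rightarrow> sph_distribution \<Rightarrow> sph_distribution" where
  "sph_op_inv Y E T \<phi> =
     (\<Sum>l. 1 / E l * (\<Sum>m\<in>{- int l..int l}. T (Y l m) * l2_inner (Y l m) \<phi>))"

text \<open>
  The continuous function that represents the distribution \<open>E\<^sup>-\<^sup>1 \<delta>\<^sub>u\<close>. It is unique; it exists if \<open>E\<close> has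
  growth order greater than \<open>2\<close>.
\<close>

definition green_function :: "sph_family \<Rightarrow> (nat \<Rightarrow> real) \<Rightarrow> real^3 \<Rightarrow> real^3 \<Rightarrow> real" where
  "green_function Y E u =
     (THE f. f \<in> extensional S2 \<and> continuous_on S2 f \<and>
             (\<forall>\<phi>. smooth_on_S2 \<phi> \<longrightarrow> l2_inner f \<phi> = sph_op_inv Y E (dirac u) \<phi>))"

definition zonal_green_kernel :: "sph_family \<Rightarrow> (nat \<Rightarrow> real) \<Rightarrow> real \<Rightarrow> real" where
  "zonal_green_kernel Y E =
     (THE \<psi>. \<psi> \<in> extensional {-1..1} \<and> (\<forall>u\<in>S2. \<forall>v\<in>S2. green_function Y E u v = \<psi> (u \<bullet> v)))"

end

theory Submission
  imports Defs "Jordan_Normal_Form.Determinant"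
begin

text \<open>
  On \<open>H\<^sub>p\<close> consider the inner product \<open>\<langle>f, g\<rangle> = \<Sum>\<^sub>l D\<^sub>l\<^sup>2 \<Sum>\<^sub>m f\<^sub>l\<^sub>m g\<^sub>l\<^sub>m\<close> of Fourier coefficients, for which
  \<open>\<langle>f, f\<rangle>\<close> is the penalty \<open>\<parallel>D f\<parallel>\<^sup>2\<close>. The Green function of the squared operator at \<open>u\<close> has the
  coefficients \<open>Y\<^sub>l\<^sub>m(u) / D\<^sub>l\<^sup>2\<close>, so pairing \<open>f\<close> with it gives the Fourier series of \<open>f\<close> at \<open>u\<close>: the
  Green kernel is the reproducing kernel of this space. Hence, for a combination
  \<open>\<mu> = \<Sum>\<^sub>q c\<^sub>q \<psi>(\<langle>\<cdot>, x\<^sub>q\<rangle>)\<close> of Green functions and any \<open>f\<close>,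
  \<open>\<parallel>D f\<parallel>\<^sup>2 = \<parallel>D \<mu>\<parallel>\<^sup>2 + \<parallel>D (f - \<mu>)\<parallel>\<^sup>2 + 2 \<Sum>\<^sub>q c\<^sub>q (f(x\<^sub>q) - \<mu>(x\<^sub>q))\<close>  (\<open>sph_op_norm_expansion\<close>).
  Expanding the data term around \<open>\<mu>\<close> produces another linear term in the differences
  \<open>f(x\<^sub>q) - \<mu>(x\<^sub>q)\<close>. The linear system for the coefficients makes the two linear terms cancel;
  then the objective at \<open>f\<close> is its value at \<open>\<mu>\<close> plus nonnegative squares, one of which is
  \<open>\<eta> \<parallel>D (f - \<mu>)\<parallel>\<^sup>2\<close> and vanishes only for \<open>f = \<mu>\<close> (\<open>is_arg_min_iff_potential\<close>). The system is
  solvable because a Gram matrix plus a positive multiple of the identity is invertible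
  (\<open>gram_nonneg\<close>, \<open>shifted_gram_invertible\<close>).

  This needs point values, the Green functions and the kernel \<open>\<psi>\<close> to make sense. All three
  rest on the kernels \<open>K\<^sub>l(u, v) = \<Sum>\<^sub>m Y\<^sub>l\<^sub>m(u) Y\<^sub>l\<^sub>m(v)\<close>. Reflections preserve the surface measure and the
  harmonic polynomials, and \<open>K\<^sub>l\<close> is the reproducing kernel of the spherical harmonics of degree \<open>l\<close>, so
  \<open>K\<^sub>l\<close> is invariant under reflections (\<open>degree_kernel_reflect\<close>). Two reflections move any pair of points
  to any other pair with the same inner product; thus \<open>K\<^sub>l(u, v)\<close> is a function of \<open>\<langle>u, v\<rangle>\<close>, and
  integrating the constant \<open>K\<^sub>l(u, u)\<close> evaluates it as \<open>(2 l + 1) / area\<close>. By Cauchy-Schwarz this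
  bounds the degree \<open>l\<close> part of a function by its coefficients, and \<open>p > 1\<close> makes both the Fourier series of
  elements of \<open>H\<^sub>p\<close> and the series of the Green functions uniformly convergent. The limits are
  recognised by their coefficients: a continuous function with zero coefficients vanishes, because the basis is complete
  and the surface measure charges every nonempty open set (\<open>zero_if_coefficients_zero\<close>). Finally,
  \<open>\<parallel>D f\<parallel>\<^sup>2\<close> refers to an \<open>L\<^sup>2\<close> limit, whose existence is the completeness of \<open>L\<^sup>2\<close>
  (\<open>L2_complete\<close>).
\<close>

section \<open>The surface measure and reflections\<close>

lemma space_surface_measure [simp]: "space surface_measure = S2"
  by (simp add: surface_measure_def space_scale_measure space_restrict_space)

lemma sets_surface_measure [measurable_cong, simp]:
  "sets surface_measure = sets (restrict_space borel S2)"
  by (simp add: surface_measure_def)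

lemma radial_projection_measurable:
  "(\<lambda>x. x /\<^sub>R norm x) \<in> measurable (restrict_space lborel (ball 0 1 - {0})) (restrict_space borel S2)"
proof (rule measurable_restrict_space2)
  show "(\<lambda>x. x /\<^sub>R norm x) \<in> space (restrict_space lborel (ball 0 1 - {0})) \<rightarrow> S2"
    by (auto simp: space_restrict_space)
  have "(\<lambda>x::real^3. x /\<^sub>R norm x) \<in> borel_measurable borel"
    by measurable
  then show "(\<lambda>x::real^3. x /\<^sub>R norm x) \<in> borel_measurable (restrict_space lborel (ball 0 1 - {0}))"
    by (intro measurable_restrict_space1) auto
qed

lemma emeasure_surface_measure:
  assumes "X \<in> sets (restrict_space borel S2)"
  shows "emeasure surface_measure X =
    3 * emeasure lborel {x \<in> ball 0 1 - {0}. x /\<^sub>R norm x \<in> X}"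
proof -
  let ?M = "restrict_space lborel (ball 0 1 - {0})" and ?C = "{x \<in> ball 0 1 - {0}. x /\<^sub>R norm x \<in> X}"
  have "emeasure (distr ?M (restrict_space borel S2) (\<lambda>x. x /\<^sub>R norm x)) X =
      emeasure ?M ((\<lambda>x. x /\<^sub>R norm x) -` X \<inter> space ?M)"
    by (rule emeasure_distr[OF radial_projection_measurable assms])
  also have "(\<lambda>x. x /\<^sub>R norm x) -` X \<inter> space ?M = ?C"
    by (auto simp: space_restrict_space)
  also have "emeasure ?M ?C = emeasure lborel ?C"
    by (rule emeasure_restrict_space) auto
  finally show ?thesis
    by (simp add: surface_measure_def ennreal_numeral[symmetric] del: ennreal_numeral)
qed

lemma cone_borel:
  assumes "X \<in> sets (restrict_space borel S2)"
  shows "{x \<in> ball 0 1 - {0}. x /\<^sub>R norm x \<in> X} \<in> sets (borel :: (real^3) measure)"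
proof -
  have "X \<in> sets borel" using assms
    by (auto simp: sets_restrict_space_iff)
  then show ?thesis by measurable
qed

interpretation surface: finite_measure surface_measure
proof
  have "{x \<in> ball 0 1 - {0}. x /\<^sub>R norm x \<in> S2} \<subseteq> (ball 0 1 :: (real^3) set)" by auto
  then have "emeasure lborel {x \<in> ball 0 1 - {0}. x /\<^sub>R norm x \<in> S2} \<le> emeasure lborel (ball 0 1 :: (real^3) set)"
    by (intro emeasure_mono) auto
  also have "\<dots> < \<infinity>" by (rule emeasure_lborel_ball_finite)
  finally show "emeasure surface_measure (space surface_measure) \<noteq> \<infinity>"
    by (subst emeasure_surface_measure) (auto simp: sets_restrict_space_iff ennreal_mult_eq_top_iff)
qed

lemma surface_measurable_continuous:
  fixes f :: "real^3 \<Rightarrow> real"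
  assumes "continuous_on S2 f"
  shows "f \<in> borel_measurable surface_measure"
proof -
  have "f \<in> borel_measurable (restrict_space borel S2)"
    by (rule borel_measurable_continuous_on_restrict[OF assms])
  then show ?thesis by (simp add: measurable_def space_restrict_space)
qed

lemma surface_integrable_continuous:
  fixes f :: "real^3 \<Rightarrow> real"
  assumes "continuous_on S2 f"
  shows "integrable surface_measure f"
proof -
  have "compact (f ` S2)" by (intro compact_continuous_image assms) auto
  then obtain B where B: "\<forall>x\<in>S2. norm (f x) \<le> B"
    by (meson bounded_iff compact_imp_bounded image_eqI)
  show ?thesis
    by (rule surface.integrable_const_bound[where B = B])
       (use B surface_measurable_continuous[OF assms] in auto)
qed

text \<open>
  The solid cone over a nonempty relatively open set of the sphere contains a ball of \<open>\<real>\<^sup>3\<close>, hence has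
  positive volume.
\<close>

lemma surface_full_support:
  fixes f :: "real^3 \<Rightarrow> real"
  assumes f: "continuous_on S2 f" and z: "integral\<^sup>L surface_measure (\<lambda>x. (f x)\<^sup>2) = 0"
  assumes x: "x \<in> S2"
  shows "f x = 0"
proof (rule ccontr)
  assume nz: "f x \<noteq> 0"
  let ?X = "{x \<in> S2. f x \<noteq> 0}"
  let ?g = "\<lambda>x. f (x /\<^sub>R norm x)"
  have "integrable surface_measure (\<lambda>x. (f x)\<^sup>2)"
    by (intro surface_integrable_continuous continuous_intros f)
  then have ae: "AE x in surface_measure. f x = 0"
    using z by (subst (asm) integral_nonneg_eq_0_iff_AE) auto
  have Xs: "?X \<in> sets (restrict_space borel S2)"
  proof -
    have "{x \<in> space surface_measure. f x \<noteq> 0} \<in> sets surface_measure"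
      using surface_measurable_continuous[OF f] by measurable
    then show ?thesis by simp
  qed
  have "emeasure surface_measure ?X = 0"
    using ae Xs by (subst (asm) AE_iff_measurable[of ?X]) auto
  then have 0: "emeasure lborel {x \<in> ball 0 1 - {0}. x /\<^sub>R norm x \<in> ?X} = 0"
    using emeasure_surface_measure[OF Xs] by auto
  have cg: "continuous_on (ball 0 1 - {0}) ?g"
    by (intro continuous_on_compose2[OF f] continuous_intros) (auto simp: field_simps split: if_splits)
  have eq: "{x \<in> ball 0 1 - {0}. x /\<^sub>R norm x \<in> ?X} = (ball 0 1 - {0}) \<inter> ?g -` (- {0})"
    by auto
  have "open \<dots>"
    by (intro continuous_open_preimage[OF cg]) auto
  then have op: "open {x \<in> ball 0 1 - {0}. x /\<^sub>R norm x \<in> ?X}" by (simp only: eq)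
  have "(1/2) *\<^sub>R x \<in> {x \<in> ball 0 1 - {0}. x /\<^sub>R norm x \<in> ?X}"
    using x nz by auto
  then obtain e where e: "e > 0" "ball ((1/2) *\<^sub>R x) e \<subseteq> {x \<in> ball 0 1 - {0}. x /\<^sub>R norm x \<in> ?X}"
    using op by (meson openE)
  have "emeasure lborel (ball ((1/2) *\<^sub>R x) e) \<le> emeasure lborel {x \<in> ball 0 1 - {0}. x /\<^sub>R norm x \<in> ?X}"
    by (rule emeasure_mono[OF e(2)]) (simp only: sets_lborel borel_open[OF op])
  then have "emeasure lborel (ball ((1/2) *\<^sub>R x) e) = 0"
    unfolding 0 by (simp only: le_zero_eq)
  then have "measure lborel (ball ((1/2) *\<^sub>R x) e) = 0"
    by (simp only: measure_def enn2real_0)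
  then show False
    using content_ball_pos[OF e(1), of "(1/2) *\<^sub>R x"] by linarith
qed

text \<open>
  The Householder reflection in the hyperplane orthogonal to \<open>a\<close>; the identity if \<open>a = 0\<close>. Being
  involutions, reflections are easier to handle than general rotations, and they suffice for all symmetry
  arguments below.
\<close>

definition reflect :: "'a::real_inner \<Rightarrow> 'a \<Rightarrow> 'a" where
  "reflect a x = x - (2 * (inner x a) / (inner a a)) *\<^sub>R a"

lemma inner_reflect_reflect: "inner (reflect a x) (reflect a y) = inner x y"
proof (cases "inner a a = 0")
  case False
  define c d where "c = 2 * inner x a / inner a a" and "d = 2 * inner y a / inner a a"
  have c: "c * inner a a = 2 * inner x a" and d: "c * inner y a = d * inner x a"
    using False by (simp_all add: c_def d_def)
  have "inner (reflect a x) (reflect a y) = inner x y - d * inner x a - c * inner y a + d * (c * inner a a)"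
    unfolding reflect_def c_def[symmetric] d_def[symmetric]
    by (simp add: inner_diff_left inner_diff_right inner_commute[of a y] right_diff_distrib)
  then show ?thesis
    by (simp add: c d)
qed (simp add: reflect_def)

lemma reflect_reflect [simp]: "reflect a (reflect a x) = x"
proof (cases "inner a a = 0")
  case False
  then have "inner (reflect a x) a = - inner x a"
    by (simp add: reflect_def inner_diff_left)
  then show ?thesis
    by (simp add: reflect_def[of a "reflect a x"]) (simp add: reflect_def)
qed (simp add: reflect_def)

lemma linear_reflect: "linear (reflect a)"
  by (rule linearI)
    (simp_all add: reflect_def inner_add_left distrib_left add_divide_distrib scaleR_add_left scaleR_diff_right)

lemma bounded_linear_reflect: "bounded_linear (reflect (a :: 'a::euclidean_space))"
  using linear_reflect[of a] by (simp only: linear_conv_bounded_linear)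

lemma orthogonal_transformation_reflect: "orthogonal_transformation (reflect a)"
  by (simp add: orthogonal_transformation_def linear_reflect inner_reflect_reflect)

lemma norm_reflect [simp]: "norm (reflect a x) = norm x"
  by (simp add: norm_eq_sqrt_inner inner_reflect_reflect)

lemma reflect_swap:
  assumes "norm x = norm y"
  shows "reflect (x - y) x = y"
proof (cases "x = y")
  case False
  have "inner x x = inner y y"
    using assms by (simp add: norm_eq_sqrt_inner)
  then have "inner (x - y) (x - y) = 2 * inner x (x - y)"
    by (simp add: inner_diff inner_commute)
  moreover have "inner (x - y) (x - y) \<noteq> 0"
    using False by simp
  ultimately show ?thesis by (simp add: reflect_def)
qed (simp add: reflect_def)

lemma reflect_orthogonal: "inner x a = 0 \<Longrightarrow> reflect a x = x"
  by (simp add: reflect_def)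

text \<open>
  A first reflection takes \<open>u\<close> to \<open>u'\<close>. The second one takes the image of \<open>v\<close> to \<open>v'\<close>; it fixes
  \<open>u'\<close> because the equality of the inner products makes \<open>u'\<close> orthogonal to the difference of the two vectors.
\<close>

lemma two_reflections_move_pair:
  assumes "norm u = norm u'" "norm v = norm v'" "inner u v = inner u' v'"
  obtains a b where "reflect b (reflect a u) = u'" "reflect b (reflect a v) = v'"
proof
  let ?a = "u - u'"
  let ?b = "reflect ?a v - v'"
  have u: "reflect ?a u = u'"
    by (rule reflect_swap[OF assms(1)])
  have "inner u' (reflect ?a v) = inner u' v'"
    using inner_reflect_reflect[of ?a u v] assms(3) by (simp add: u)
  then show "reflect ?b (reflect ?a u) = u'"
    by (simp add: u reflect_orthogonal inner_diff)
  show "reflect ?b (reflect ?a v) = v'"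
    by (rule reflect_swap) (simp add: assms)
qed

lemma reflect_borel_measurable [measurable]:
  "reflect (a :: 'a::euclidean_space) \<in> borel_measurable borel"
  by (intro borel_measurable_continuous_onI linear_continuous_on bounded_linear_reflect)

lemma emeasure_lborel_reflect_preimage:
  fixes S :: "(real^3) set"
  assumes S: "S \<in> sets borel" "bounded S"
  shows "emeasure lborel (reflect a -` S) = emeasure lborel S"
proof -
  have im: "reflect a -` S = reflect a ` S"
    by (auto intro!: image_eqI[of _ _ "reflect a _"] simp: image_iff)
  have lm: "S \<in> lmeasurable"
    using S by (simp add: bounded_set_imp_lmeasurable)
  have lm': "reflect a -` S \<in> lmeasurable"
    unfolding im by (rule measurable_orthogonal_image[OF orthogonal_transformation_reflect lm])
  have b: "reflect a -` S \<in> sets borel"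
    using measurable_sets[OF reflect_borel_measurable S(1)] by simp
  have "emeasure lebesgue (reflect a -` S) = emeasure lebesgue S"
    using lm lm' measure_orthogonal_image[OF orthogonal_transformation_reflect lm, of a]
    by (metis emeasure_eq_ennreal_measure fmeasurableD2 im)
  then show ?thesis
    using b S by simp
qed

lemma reflect_measurable_surface [measurable]:
  "reflect a \<in> measurable surface_measure surface_measure"
proof -
  have "reflect a \<in> measurable (restrict_space borel S2) (restrict_space borel S2)"
    by (rule measurable_restrict_space2)
      (auto simp: space_restrict_space intro!: measurable_restrict_space1)
  then show ?thesis
    by (simp add: measurable_def space_restrict_space)
qed

text \<open>
  Reflections map the cone over a set to the cone over the image, and they preserve volumes.
\<close>

lemma distr_surface_reflect:
  "distr surface_measure surface_measure (reflect a) = surface_measure"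
proof (rule measure_eqI)
  note m = reflect_measurable_surface[of a]
  fix X assume X: "X \<in> sets (distr surface_measure surface_measure (reflect a))"
  then have X': "X \<in> sets (restrict_space borel S2)" by simp
  let ?C = "{x \<in> ball 0 1 - {0}. x /\<^sub>R norm x \<in> X}"
  have P: "reflect a -` X \<inter> S2 \<in> sets (restrict_space borel S2)"
    using measurable_sets[OF m, of X] X by simp
  have r0: "reflect a x = 0 \<longleftrightarrow> x = 0" for x :: "real^3"
    by (metis norm_eq_zero norm_reflect)
  have "{x \<in> ball 0 1 - {0}. x /\<^sub>R norm x \<in> reflect a -` X \<inter> S2} = reflect a -` ?C"
    by (auto simp: linear_cmul[OF linear_reflect] r0)
  moreover have "bounded ?C"
    by (rule bounded_subset[OF bounded_ball[of 0 1]]) auto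
  ultimately show "emeasure (distr surface_measure surface_measure (reflect a)) X = emeasure surface_measure X"
    using X emeasure_lborel_reflect_preimage[OF cone_borel[OF X'], of a]
    by (simp add: emeasure_distr[OF m] emeasure_surface_measure[OF P] emeasure_surface_measure[OF X'])
qed simp

lemma integral_surface_reflect:
  fixes f :: "real^3 \<Rightarrow> real"
  assumes "f \<in> borel_measurable surface_measure"
  shows "integral\<^sup>L surface_measure (\<lambda>x. f (reflect a x)) = integral\<^sup>L surface_measure f"
  using integral_distr[OF reflect_measurable_surface assms, of a]
  by (simp add: distr_surface_reflect)

section \<open>Square-integrable functions\<close>

lemma integrable_mult_of_squares:
  fixes f g :: "'a \<Rightarrow> real"
  assumes [measurable]: "f \<in> borel_measurable M" "g \<in> borel_measurable M"
    and f: "integrable M (\<lambda>x. (f x)\<^sup>2)" and g: "integrable M (\<lambda>x. (g x)\<^sup>2)"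
  shows "integrable M (\<lambda>x. f x * g x)"
proof (rule Bochner_Integration.integrable_bound)
  show "integrable M (\<lambda>x. (f x)\<^sup>2 + (g x)\<^sup>2)"
    using f g by (rule Bochner_Integration.integrable_add)
  have "\<bar>a * b\<bar> \<le> a\<^sup>2 + b\<^sup>2" for a b :: real
  proof -
    have "2 * (\<bar>a\<bar> * \<bar>b\<bar>) \<le> a\<^sup>2 + b\<^sup>2"
      using sum_squares_bound[of "\<bar>a\<bar>" "\<bar>b\<bar>"] by (simp add: mult.assoc)
    then show ?thesis
      unfolding abs_mult using mult_nonneg_nonneg[of "\<bar>a\<bar>" "\<bar>b\<bar>"] by linarith
  qed
  then show "AE x in M. norm (f x * g x) \<le> norm ((f x)\<^sup>2 + (g x)\<^sup>2)" by auto
qed measurable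

lemma integrable_square_add:
  fixes f g :: "'a \<Rightarrow> real"
  assumes "f \<in> borel_measurable M" "g \<in> borel_measurable M"
    and "integrable M (\<lambda>x. (f x)\<^sup>2)" "integrable M (\<lambda>x. (g x)\<^sup>2)"
  shows "integrable M (\<lambda>x. (f x + g x)\<^sup>2)"
  using integrable_mult_of_squares[OF assms] assms(3,4)
  by (simp add: power2_sum mult.assoc)

lemma integral_Cauchy_Schwarz:
  fixes f g :: "'a \<Rightarrow> real"
  assumes [measurable]: "f \<in> borel_measurable M" "g \<in> borel_measurable M"
    and f: "integrable M (\<lambda>x. (f x)\<^sup>2)" and g: "integrable M (\<lambda>x. (g x)\<^sup>2)"
  shows "(integral\<^sup>L M (\<lambda>x. f x * g x))\<^sup>2 \<le> integral\<^sup>L M (\<lambda>x. (f x)\<^sup>2) * integral\<^sup>L M (\<lambda>x. (g x)\<^sup>2)"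
    (is "?I\<^sup>2 \<le> ?F * ?G")
proof -
  have fg: "integrable M (\<lambda>x. f x * g x)"
    by (rule integrable_mult_of_squares) (use f g in auto)
  have q: "0 \<le> ?F + 2 * t * ?I + t\<^sup>2 * ?G" for t
  proof -
    have "0 \<le> integral\<^sup>L M (\<lambda>x. (f x + t * g x)\<^sup>2)" by simp
    also have "(\<lambda>x. (f x + t * g x)\<^sup>2) = (\<lambda>x. (f x)\<^sup>2 + (2 * t) * (f x * g x) + t\<^sup>2 * (g x)\<^sup>2)"
      by (auto simp: power2_sum algebra_simps)
    also have "integral\<^sup>L M \<dots> = ?F + 2 * t * ?I + t\<^sup>2 * ?G"
      using f g fg by simp
    finally show ?thesis .
  qed
  show ?thesis
  proof (cases "?G = 0")
    case True
    have "?I = 0"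
    proof (rule ccontr)
      assume "?I \<noteq> 0"
      then have "2 * (- (?F + 1) / (2 * ?I)) * ?I = - (?F + 1)" by simp
      then show False
        using q[of "- (?F + 1) / (2 * ?I)"] unfolding True by linarith
    qed
    then show ?thesis using True by simp
  next
    case False
    then have G: "?G > 0" by (simp add: order_less_le)
    have "0 \<le> (?F + 2 * (- ?I / ?G) * ?I + (- ?I / ?G)\<^sup>2 * ?G) * ?G"
      using q[of "- ?I / ?G"] G by (intro mult_nonneg_nonneg) auto
    also have "\<dots> = ?F * ?G - ?I\<^sup>2"
      using G by (simp add: field_simps power2_eq_square)
    finally show ?thesis by simp
  qed
qed

text \<open>
  The Riesz-Fischer theorem for a finite measure. Along a subsequence the increments have square norms
  at most \<open>4\<^sup>-\<^sup>j\<close>, hence summable integrals, so that the subsequence converges almost everywhere;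
  Fatou's lemma shows that the pointwise limit is the limit in \<open>L\<^sup>2\<close>.
\<close>

lemma (in finite_measure) L2_complete:
  fixes S :: "nat \<Rightarrow> 'a \<Rightarrow> real"
  assumes [measurable]: "\<And>k. S k \<in> borel_measurable M"
    and int: "\<And>k. integrable M (\<lambda>x. (S k x)\<^sup>2)"
    and cauchy: "\<And>e. e > 0 \<Longrightarrow> \<exists>N. \<forall>m\<ge>N. \<forall>k\<ge>N. integral\<^sup>L M (\<lambda>x. (S m x - S k x)\<^sup>2) < e"
  obtains g where "g \<in> borel_measurable M" "integrable M (\<lambda>x. (g x)\<^sup>2)"
    "(\<lambda>N. integral\<^sup>L M (\<lambda>x. (g x - S N x)\<^sup>2)) \<longlonglongrightarrow> 0"
proof -
  have idiff: "integrable M (\<lambda>x. (S m x - S k x)\<^sup>2)" for m k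
    using integrable_square_add[of "S m" M "\<lambda>x. - S k x"] int by simp
  have "\<forall>j. \<exists>N. \<forall>m\<ge>N. \<forall>k\<ge>N. integral\<^sup>L M (\<lambda>x. (S m x - S k x)\<^sup>2) < (1/4)^j"
    using cauchy by simp
  then obtain N where N: "\<And>j m k. m \<ge> N j \<Longrightarrow> k \<ge> N j \<Longrightarrow> integral\<^sup>L M (\<lambda>x. (S m x - S k x)\<^sup>2) < (1/4)^j"
    by metis
  \<comment> \<open>Only \<open>r j \<ge> N i\<close> for \<open>i \<le> j\<close> matters; the partial sums of \<open>N\<close> are a convenient such choice.\<close>
  define r where "r j = (\<Sum>i\<le>j. N i)" for j
  have rN: "r j \<ge> N i" if "i \<le> j" for i j
    unfolding r_def by (rule member_le_sum) (use that in auto)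
  define d where "d j x = S (r (Suc j)) x - S (r j) x" for j x
  have dm [measurable]: "d j \<in> borel_measurable M" for j
    unfolding d_def by measurable
  have d2: "integrable M (\<lambda>x. (d j x)\<^sup>2)" for j
    unfolding d_def by (rule idiff)
  have di: "integrable M (d j)" for j
    by (rule square_integrable_imp_integrable[OF dm d2])
  let ?C = "1 + measure M (space M)"
  have dle: "integral\<^sup>L M (\<lambda>x. \<bar>d j x\<bar>) \<le> (1/2)^j * ?C" for j
  proof -
    have "integral\<^sup>L M (\<lambda>x. \<bar>d j x\<bar>) \<le> integral\<^sup>L M (\<lambda>x. 2^j * (d j x)\<^sup>2 + (1/2)^j)"
    proof (rule integral_mono)
      fix x
      \<comment> \<open>Since \<open>y \<le> y\<^sup>2 + 1\<close>, scaled by \<open>2\<^sup>-\<^sup>j\<close>; this trades a factor \<open>2\<^sup>j\<close> for the passage from \<open>\<bar>d\<bar>\<close> to \<open>d\<^sup>2\<close>.\<close>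
      define y where "y = 2^j * \<bar>d j x\<bar>"
      have h: "(1/2)^j * (2::real)^j = 1"
        by (simp add: power_one_over)
      have "y \<ge> 0" by (simp add: y_def)
      moreover have "0 \<le> y\<^sup>2 - 2 * y + 1"
        using zero_le_power2[of "y - 1"] by (simp add: power2_diff)
      ultimately have "y \<le> y\<^sup>2 + 1" by linarith
      then have "(1/2)^j * y \<le> (1/2)^j * (y\<^sup>2 + 1)"
        by (intro mult_left_mono) auto
      also have "\<dots> = ((1/2)^j * 2^j) * 2^j * (d j x)\<^sup>2 + (1/2)^j"
        by (simp add: y_def power2_eq_square distrib_left mult_ac)
      finally have "((1/2)^j * 2^j) * \<bar>d j x\<bar> \<le> ((1/2)^j * 2^j) * 2^j * (d j x)\<^sup>2 + (1/2)^j"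
        by (simp add: y_def mult.assoc)
      then show "\<bar>d j x\<bar> \<le> 2^j * (d j x)\<^sup>2 + (1/2)^j"
        unfolding h by simp
    qed (use di d2 in auto)
    also have "\<dots> = 2^j * integral\<^sup>L M (\<lambda>x. (d j x)\<^sup>2) + (1/2)^j * measure M (space M)"
      using d2 by simp
    also have "\<dots> \<le> 2^j * (1/4)^j + (1/2)^j * measure M (space M)"
      using N[of j "r (Suc j)" "r j"] rN[of j "Suc j"] rN[of j j]
      by (intro add_right_mono mult_left_mono) (auto simp: d_def)
    also have "(2::real)^j * (1/4)^j = (1/2)^j"
      by (simp flip: power_mult_distrib)
    finally show ?thesis by (simp add: algebra_simps)
  qed
  have sm: "summable (\<lambda>j. integral\<^sup>L M (\<lambda>x. \<bar>d j x\<bar>))"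
    by (rule summable_comparison_test'[where g = "\<lambda>j. (1/2)^j * ?C" and N = 0])
       (use dle in \<open>auto intro!: summable_mult2 summable_geometric\<close>)
  have "(\<integral>\<^sup>+x. (\<Sum>j. ennreal \<bar>d j x\<bar>) \<partial>M) = (\<Sum>j. \<integral>\<^sup>+x. ennreal \<bar>d j x\<bar> \<partial>M)"
    by (rule nn_integral_suminf) measurable
  also have "\<dots> = (\<Sum>j. ennreal (integral\<^sup>L M (\<lambda>x. \<bar>d j x\<bar>)))"
    using di by (intro suminf_cong nn_integral_eq_integral) auto
  also have "\<dots> \<noteq> \<infinity>"
    using sm by (subst suminf_ennreal2) auto
  finally have "AE x in M. (\<Sum>j. ennreal \<bar>d j x\<bar>) \<noteq> \<infinity>"
    by (intro nn_integral_PInf_AE) auto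
  then have conv: "AE x in M. convergent (\<lambda>j. S (r j) x)"
  proof eventually_elim
    case (elim x)
    then have "summable (\<lambda>j. \<bar>d j x\<bar>)"
      by (intro summable_suminf_not_top) auto
    then have "summable (\<lambda>j. d j x)"
      by (rule summable_rabs_cancel)
    then have "convergent (\<lambda>n. \<Sum>j<n. d j x)"
      by (simp add: summable_iff_convergent)
    then have "convergent (\<lambda>n. (\<Sum>j<n. d j x) + S (r 0) x)"
      by (intro convergent_add convergent_const)
    moreover have "(\<Sum>j<n. d j x) + S (r 0) x = S (r n) x" for n
      by (induction n) (auto simp: d_def)
    ultimately show ?case by simp
  qed
  define g where "g x = lim (\<lambda>j. S (r j) x)" for x
  have gm [measurable]: "g \<in> borel_measurable M"
    unfolding g_def by measurable
  have lim: "AE x in M. (\<lambda>j. S (r j) x) \<longlonglongrightarrow> g x"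
    using conv by eventually_elim (simp add: g_def convergent_LIMSEQ_iff)
  \<comment> \<open>Fatou for the squared distances along the subsequence, with \<open>S k\<close> held fixed.\<close>
  have bound: "(\<integral>\<^sup>+x. ennreal ((g x - S k x)\<^sup>2) \<partial>M) \<le> ennreal ((1/4)^i)" if k: "k \<ge> N i" for k i
  proof -
    have "(\<integral>\<^sup>+x. ennreal ((g x - S k x)\<^sup>2) \<partial>M) = (\<integral>\<^sup>+x. liminf (\<lambda>j. ennreal ((S (r j) x - S k x)\<^sup>2)) \<partial>M)"
    proof (rule nn_integral_cong_AE)
      show "AE x in M. ennreal ((g x - S k x)\<^sup>2) = liminf (\<lambda>j. ennreal ((S (r j) x - S k x)\<^sup>2))"
        using lim
      proof eventually_elim
        case (elim x)
        have "(\<lambda>j. ennreal ((S (r j) x - S k x)\<^sup>2)) \<longlonglongrightarrow> ennreal ((g x - S k x)\<^sup>2)"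
          by (intro tendsto_ennrealI tendsto_intros elim)
        from lim_imp_Liminf[OF _ this] show ?case by simp
      qed
    qed
    also have "\<dots> \<le> liminf (\<lambda>j. \<integral>\<^sup>+x. ennreal ((S (r j) x - S k x)\<^sup>2) \<partial>M)"
      by (rule nn_integral_liminf) measurable
    also have "\<dots> \<le> ennreal ((1/4)^i)"
    proof (rule Liminf_le)
      show "\<forall>\<^sub>F j in sequentially. (\<integral>\<^sup>+x. ennreal ((S (r j) x - S k x)\<^sup>2) \<partial>M) \<le> ennreal ((1/4)^i)"
      proof (rule eventually_sequentiallyI[of i])
        fix j assume "i \<le> j"
        then have "integral\<^sup>L M (\<lambda>x. (S (r j) x - S k x)\<^sup>2) < (1/4)^i"
          by (intro N rN k)
        then show "(\<integral>\<^sup>+x. ennreal ((S (r j) x - S k x)\<^sup>2) \<partial>M) \<le> ennreal ((1/4)^i)"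
          by (subst nn_integral_eq_integral[OF idiff]) (auto intro: ennreal_leI)
      qed
    qed simp
    finally show ?thesis .
  qed
  have gd: "integrable M (\<lambda>x. (g x - S k x)\<^sup>2)" if k: "k \<ge> N 0" for k
  proof (rule integrableI_bounded)
    show "(\<integral>\<^sup>+x. ennreal (norm ((g x - S k x)\<^sup>2)) \<partial>M) < \<infinity>"
      using bound[OF k] by (simp add: order_le_less_trans)
  qed measurable
  have g2: "integrable M (\<lambda>x. (g x)\<^sup>2)"
    using integrable_square_add[of "\<lambda>x. g x - S (N 0) x" M "S (N 0)"] gd[of "N 0"] int by simp
  have gd': "integrable M (\<lambda>x. (g x - S k x)\<^sup>2)" for k
    using integrable_square_add[of g M "\<lambda>x. - S k x"] int g2 by simp
  have "(\<lambda>k. integral\<^sup>L M (\<lambda>x. (g x - S k x)\<^sup>2)) \<longlonglongrightarrow> 0"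
  proof (rule LIMSEQ_I)
    fix e :: real assume "e > 0"
    then obtain i where i: "(1/4)^i < e"
      using real_arch_pow_inv[of e "1/4"] by auto
    show "\<exists>no. \<forall>k\<ge>no. norm (integral\<^sup>L M (\<lambda>x. (g x - S k x)\<^sup>2) - 0) < e"
    proof (intro exI allI impI)
      fix k assume "k \<ge> N i"
      then have "ennreal (integral\<^sup>L M (\<lambda>x. (g x - S k x)\<^sup>2)) \<le> ennreal ((1/4)^i)"
        using bound[of i k] nn_integral_eq_integral[OF gd'[of k]] by simp
      then have "integral\<^sup>L M (\<lambda>x. (g x - S k x)\<^sup>2) \<le> (1/4)^i"
        by (subst (asm) ennreal_le_iff) auto
      then show "norm (integral\<^sup>L M (\<lambda>x. (g x - S k x)\<^sup>2) - 0) < e"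
        using i by simp
    qed
  qed
  then show ?thesis using that gm g2 by blast
qed

section \<open>Spherical harmonics under reflections\<close>

lemma real_polynomial_function_has_derivative:
  assumes "real_polynomial_function P"
  obtains D where "\<And>x. (P has_derivative D x) (at x)" "\<And>b. real_polynomial_function (\<lambda>x. D x b)"
proof -
  have "\<exists>D. (\<forall>x. (P has_derivative D x) (at x)) \<and> (\<forall>b. real_polynomial_function (\<lambda>x. D x b))"
    using assms
  proof induction
    case (linear f)
    then show ?case
      by (intro exI[of _ "\<lambda>x. f"]) (auto intro: bounded_linear_imp_has_derivative)
  next
    case (const c)
    then show ?case by (intro exI[of _ "\<lambda>x h. 0"]) auto
  next
    case (add f g)
    then obtain F G where "\<And>x. (f has_derivative F x) (at x)" "\<And>b. real_polynomial_function (\<lambda>x. F x b)"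
      "\<And>x. (g has_derivative G x) (at x)" "\<And>b. real_polynomial_function (\<lambda>x. G x b)"
      by blast
    then show ?case
      by (intro exI[of _ "\<lambda>x h. F x h + G x h"]) (auto intro!: derivative_intros)
  next
    case (mult f g)
    then obtain F G where "\<And>x. (f has_derivative F x) (at x)" "\<And>b. real_polynomial_function (\<lambda>x. F x b)"
      "\<And>x. (g has_derivative G x) (at x)" "\<And>b. real_polynomial_function (\<lambda>x. G x b)"
      by blast
    moreover have "real_polynomial_function (\<lambda>x. f x * G x b + F x b * g x)" for b
      by (intro real_polynomial_function.intros(3,4) mult.hyps) fact+
    ultimately show ?case
      by (intro exI[of _ "\<lambda>x h. f x * G x h + F x h * g x"]) (auto intro!: has_derivative_mult)
  qed
  then show ?thesis using that by blast
qed

lemma real_polynomial_function_frechet_derivative: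
  assumes "real_polynomial_function P"
  shows "(P has_derivative frechet_derivative P (at x)) (at x)"
    and "real_polynomial_function (\<lambda>x. frechet_derivative P (at x) b)"
proof -
  obtain D where D: "\<And>x. (P has_derivative D x) (at x)" "\<And>b. real_polynomial_function (\<lambda>x. D x b)"
    using real_polynomial_function_has_derivative[OF assms] by blast
  have "D x = frechet_derivative P (at x)" for x
    by (rule frechet_derivative_at[OF D(1)])
  with D show "(P has_derivative frechet_derivative P (at x)) (at x)"
    and "real_polynomial_function (\<lambda>x. frechet_derivative P (at x) b)"
    by auto
qed

lemma C_diff_polynomial: "real_polynomial_function P \<Longrightarrow> C_diff k P"
proof (induction k arbitrary: P)
  case 0
  then show ?case
    using real_polynomial_function_frechet_derivative(1)[OF 0]
    by (auto intro!: has_derivative_continuous_on)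
next
  case (Suc k)
  have "P differentiable_on UNIV"
    using real_polynomial_function_frechet_derivative(1)[OF Suc.prems]
    by (auto simp: differentiable_on_def differentiable_def)
  then show ?case
    using Suc.IH real_polynomial_function_frechet_derivative(2)[OF Suc.prems] by simp
qed

text \<open>
  The trace of a bilinear form is the same in every orthonormal basis, here in the reflected one.
\<close>

lemma sum_bilinear_reflect:
  fixes H :: "'a::euclidean_space \<Rightarrow> 'a \<Rightarrow> real"
  assumes H: "bilinear H"
  shows "(\<Sum>b\<in>Basis. H (reflect a b) (reflect a b)) = (\<Sum>b\<in>Basis. H b b)"
proof -
  have adj: "inner (reflect a b) c = inner b (reflect a c)" for b c
    using inner_reflect_reflect[of a b "reflect a c"] by simp
  have "H (reflect a b) (reflect a b) =
      (\<Sum>(c, d)\<in>Basis \<times> Basis. inner b (reflect a c) * inner b (reflect a d) * H c d)" for b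
  proof -
    have "H (reflect a b) (reflect a b) =
      H (\<Sum>c\<in>Basis. inner (reflect a b) c *\<^sub>R c) (\<Sum>d\<in>Basis. inner (reflect a b) d *\<^sub>R d)"
      by (simp add: euclidean_representation)
    also have "\<dots> = (\<Sum>(c, d)\<in>Basis \<times> Basis. H (inner (reflect a b) c *\<^sub>R c) (inner (reflect a b) d *\<^sub>R d))"
      by (rule bilinear_sum[OF H])
    finally show ?thesis
      by (simp add: bilinear_lmul[OF H] bilinear_rmul[OF H] adj mult_ac case_prod_unfold)
  qed
  then have "(\<Sum>b\<in>Basis. H (reflect a b) (reflect a b)) =
      (\<Sum>(c, d)\<in>Basis \<times> Basis. \<Sum>b\<in>Basis. inner b (reflect a c) * inner b (reflect a d) * H c d)"
    by (simp add: case_prod_unfold) (rule sum.swap)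
  also have "\<dots> = (\<Sum>(c, d)\<in>Basis \<times> Basis. inner c d * H c d)"
  proof (rule sum.cong, safe)
    fix c d :: 'a
    have "(\<Sum>b\<in>Basis. inner b (reflect a c) * inner b (reflect a d)) = inner c d"
      using euclidean_inner[of "reflect a c" "reflect a d"]
      by (simp add: inner_reflect_reflect inner_commute)
    then show "(\<Sum>b\<in>Basis. inner b (reflect a c) * inner b (reflect a d) * H c d) = inner c d * H c d"
      by (simp flip: sum_distrib_right)
  qed
  also have "\<dots> = (\<Sum>c\<in>Basis. \<Sum>d\<in>Basis. if c = d then H c d else 0)"
    unfolding sum.cartesian_product[symmetric]
    by (intro sum.cong refl) (auto simp: inner_Basis)
  also have "\<dots> = (\<Sum>b\<in>Basis. H b b)" by simp
  finally show ?thesis .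
qed

text \<open>
  By the chain rule the left hand side is the trace of the Hessian of \<open>P\<close>, at the reflected point, in the reflected
  basis.
\<close>

lemma laplacian_reflect:
  assumes P: "real_polynomial_function P"
  shows "laplacian (\<lambda>x. P (reflect a x)) x = laplacian P (reflect a x)"
proof -
  have chain: "frechet_derivative (\<lambda>y. Q (reflect a y)) (at y) b = frechet_derivative Q (at (reflect a y)) (reflect a b)"
    if "real_polynomial_function Q" for Q :: "real^3 \<Rightarrow> real" and y b
  proof -
    have "(reflect a has_derivative reflect a) (at y)"
      by (intro bounded_linear_imp_has_derivative bounded_linear_reflect)
    then have "((\<lambda>y. Q (reflect a y)) has_derivative (\<lambda>b. frechet_derivative Q (at (reflect a y)) (reflect a b))) (at y)"
      by (rule has_derivative_compose)
        (rule real_polynomial_function_frechet_derivative(1)[OF that])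
    from frechet_derivative_at[OF this] show ?thesis by metis
  qed
  let ?D = "\<lambda>c z. frechet_derivative P (at z) c"
  note DP = real_polynomial_function_frechet_derivative(2)[OF P]
  define H where "H c d = frechet_derivative (?D c) (at (reflect a x)) d" for c d
  have linP: "linear (frechet_derivative P (at z))" for z
    by (rule has_derivative_linear[OF real_polynomial_function_frechet_derivative(1)[OF P]])
  have "bilinear H"
    unfolding bilinear_def
  proof safe
    fix c show "linear (H c)"
      unfolding H_def
      by (rule has_derivative_linear[OF real_polynomial_function_frechet_derivative(1)[OF DP]])
  next
    fix d
    note hd = real_polynomial_function_frechet_derivative(1)[OF DP, of _ "reflect a x"]
    have "H (c + c') d = H c d + H c' d" for c c'
      unfolding H_def linear_add[OF linP]
      by (simp only: frechet_derivative_at[OF has_derivative_add[OF hd[of c] hd[of c']], symmetric])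
    moreover have "H (k *\<^sub>R c) d = k *\<^sub>R H c d" for k c
      unfolding H_def linear_cmul[OF linP]
      by (simp only: frechet_derivative_at[OF has_derivative_scaleR_right[OF hd[of c], of k], symmetric])
    ultimately show "linear (\<lambda>c. H c d)"
      by (rule linearI)
  qed
  have "laplacian (\<lambda>x. P (reflect a x)) x = (\<Sum>b\<in>Basis. H (reflect a b) (reflect a b))"
    unfolding laplacian_def H_def by (simp add: chain[OF P] chain[OF DP])
  also have "\<dots> = (\<Sum>b\<in>Basis. H b b)"
    by (rule sum_bilinear_reflect[OF \<open>bilinear H\<close>])
  finally show ?thesis by (simp add: laplacian_def H_def)
qed

lemma spherical_harmonic_reflect:
  assumes "spherical_harmonic l f"
  shows "spherical_harmonic l (\<lambda>x. f (reflect a x))"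
proof -
  obtain P where P: "real_polynomial_function P" "\<And>c x. P (c *\<^sub>R x) = c ^ l * P x"
    "\<And>x. laplacian P x = 0" "\<And>x. x \<in> S2 \<Longrightarrow> f x = P x"
    using assms by (auto simp: spherical_harmonic_def)
  have "polynomial_function (reflect a :: real^3 \<Rightarrow> _)"
    by (intro polynomial_function_bounded_linear bounded_linear_reflect)
  then have "real_polynomial_function (\<lambda>x. P (reflect a x))"
    using real_polynomial_function_compose[OF _ P(1)] by (simp add: o_def)
  then show ?thesis
    unfolding spherical_harmonic_def using P
    by (intro exI[of _ "\<lambda>x. P (reflect a x)"])
       (auto simp: linear_cmul[OF linear_reflect] laplacian_reflect)
qed

lemma spherical_harmonic_continuous:
  assumes "spherical_harmonic l f"
  shows "continuous_on S2 f"
proof -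
  obtain P where P: "real_polynomial_function P" "\<And>x. x \<in> S2 \<Longrightarrow> f x = P x"
    using assms by (auto simp: spherical_harmonic_def)
  have "continuous_on S2 P"
    using C_diff_polynomial[OF P(1), of 0] by (auto intro: continuous_on_subset)
  then show ?thesis
    by (rule continuous_on_eq) (simp add: P)
qed

lemma spherical_harmonic_smooth:
  assumes "spherical_harmonic l f"
  shows "smooth_on_S2 f"
  using assms C_diff_polynomial by (auto simp: spherical_harmonic_def smooth_on_S2_def)

lemma smooth_on_S2_continuous:
  assumes "smooth_on_S2 f"
  shows "continuous_on S2 f"
proof -
  obtain g where g: "\<And>k. C_diff k g" "\<And>x. x \<in> S2 \<Longrightarrow> f x = g x"
    using assms unfolding smooth_on_S2_def by blast
  have "continuous_on S2 g"
    using g(1)[of 0] by (auto intro: continuous_on_subset)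
  then show ?thesis
    by (rule continuous_on_eq) (simp add: g)
qed

section \<open>The inner product of functions on the sphere\<close>

lemma l2_inner_cong:
  assumes "\<And>x. x \<in> S2 \<Longrightarrow> f x = f' x" "\<And>x. x \<in> S2 \<Longrightarrow> g x = g' x"
  shows "l2_inner f g = l2_inner f' g'"
  unfolding l2_inner_def by (rule Bochner_Integration.integral_cong) (use assms in auto)

lemma l2_inner_commute: "l2_inner f g = l2_inner g f"
  by (simp add: l2_inner_def mult.commute)

lemma square_integrable_continuous: "continuous_on S2 f \<Longrightarrow> square_integrable f"
  by (auto simp: square_integrable_def intro!: surface_measurable_continuous
      surface_integrable_continuous continuous_intros)

lemma l2_inner_diff:
  assumes "continuous_on S2 f" "continuous_on S2 f'" "continuous_on S2 g"
  shows "l2_inner (\<lambda>x. f x - f' x) g = l2_inner f g - l2_inner f' g"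
  unfolding l2_inner_def left_diff_distrib
  by (intro Bochner_Integration.integral_diff surface_integrable_continuous continuous_intros assms)

lemma l2_inner_sum:
  assumes "\<And>i. i \<in> I \<Longrightarrow> continuous_on S2 (f i)" "continuous_on S2 g"
  shows "l2_inner (\<lambda>x. \<Sum>i\<in>I. c i * f i x) g = (\<Sum>i\<in>I. c i * l2_inner (f i) g)"
proof -
  have "integrable surface_measure (\<lambda>x. f i x * g x)" if "i \<in> I" for i
    by (intro surface_integrable_continuous continuous_intros assms that)
  then show ?thesis
    by (simp add: l2_inner_def sum_distrib_right mult.assoc)
qed

lemma l2_inner_sum':
  assumes "\<And>i. i \<in> I \<Longrightarrow> continuous_on S2 (f i)" "continuous_on S2 g"
  shows "l2_inner (\<lambda>x. \<Sum>i\<in>I. f i x) g = (\<Sum>i\<in>I. l2_inner (f i) g)"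
  using l2_inner_sum[of I f g "\<lambda>_. 1"] assms by simp

lemma l2_norm_square: "(l2_norm f)\<^sup>2 = l2_inner f f"
  by (simp add: l2_norm_def l2_inner_def)

lemma continuous_l2_norm_zero:
  assumes "continuous_on S2 f" "l2_norm f = 0" "x \<in> S2"
  shows "f x = 0"
proof (rule surface_full_support[OF assms(1) _ assms(3)])
  have "l2_inner f f = 0"
    using assms(2) l2_norm_square[of f] by simp
  then show "integral\<^sup>L surface_measure (\<lambda>x. (f x)\<^sup>2) = 0"
    by (simp add: l2_inner_def power2_eq_square)
qed

text \<open>
  Allows term-by-term integration of uniformly convergent expansions against a continuous function.
\<close>

lemma l2_inner_uniform_limit:
  assumes u: "uniform_limit S2 g F sequentially"
    and g: "\<And>N. continuous_on S2 (g N)" and \<phi>: "continuous_on S2 \<phi>"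
  shows "(\<lambda>N. l2_inner (g N) \<phi>) \<longlonglongrightarrow> l2_inner F \<phi>"
proof (rule LIMSEQ_I)
  have F: "continuous_on S2 F"
    by (rule uniform_limit_theorem[OF _ u]) (use g in auto)
  let ?B = "integral\<^sup>L surface_measure (\<lambda>x. \<bar>\<phi> x\<bar>)"
  have i\<phi>: "integrable surface_measure (\<lambda>x. \<bar>\<phi> x\<bar>)"
    by (intro surface_integrable_continuous continuous_intros \<phi>)
  have B: "?B \<ge> 0" by simp
  fix e :: real assume e: "e > 0"
  define d where "d = e / (?B + 1)"
  have "d > 0" "d * (?B + 1) = e"
    using e B by (simp_all add: d_def add_nonneg_pos add_nonneg_eq_0_iff)
  then have d: "d > 0" "d * ?B < e"
    by (auto simp only: distrib_left mult_1_right)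
  obtain N0 where N0: "\<And>N x. N \<ge> N0 \<Longrightarrow> x \<in> S2 \<Longrightarrow> dist (g N x) (F x) < d"
    using uniform_limitD[OF u d(1)] unfolding eventually_sequentially by blast
  show "\<exists>no. \<forall>N\<ge>no. norm (l2_inner (g N) \<phi> - l2_inner F \<phi>) < e"
  proof (intro exI allI impI)
    fix N assume N: "N \<ge> N0"
    have "norm (l2_inner (g N) \<phi> - l2_inner F \<phi>) = norm (l2_inner (\<lambda>x. g N x - F x) \<phi>)"
      by (simp add: l2_inner_diff[OF g F \<phi>])
    also have "\<dots> \<le> integral\<^sup>L surface_measure (\<lambda>x. norm ((g N x - F x) * \<phi> x))"
      unfolding l2_inner_def by (rule integral_norm_bound)
    also have "\<dots> \<le> integral\<^sup>L surface_measure (\<lambda>x. d * \<bar>\<phi> x\<bar>)"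
    proof (rule integral_mono)
      show "integrable surface_measure (\<lambda>x. norm ((g N x - F x) * \<phi> x))"
        by (intro surface_integrable_continuous continuous_intros g F \<phi>)
      fix x assume "x \<in> space surface_measure"
      then show "norm ((g N x - F x) * \<phi> x) \<le> d * \<bar>\<phi> x\<bar>"
        using N0[OF N, of x] by (auto simp: dist_real_def abs_mult intro!: mult_right_mono)
    qed (use i\<phi> in simp)
    also have "\<dots> = d * ?B" by simp
    finally show "norm (l2_inner (g N) \<phi> - l2_inner F \<phi>) < e" using d(2) by linarith
  qed
qed

section \<open>The reproducing kernels of the spherical harmonics\<close>

locale spherical_basis =
  fixes Y :: sph_family
  assumes basis: "spherical_harmonic_basis Y"
begin

abbreviation orders :: "nat \<Rightarrow> int set" where "orders l \<equiv> {- int l..int l}"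

lemma Y_harmonic: "m \<in> orders l \<Longrightarrow> spherical_harmonic l (Y l m)"
  using basis by (simp add: spherical_harmonic_basis_def)

lemma Y_continuous [continuous_intros]: "m \<in> orders l \<Longrightarrow> continuous_on S2 (Y l m)"
  using Y_harmonic spherical_harmonic_continuous by blast

lemma Y_span:
  assumes "spherical_harmonic l f"
  obtains c where "\<And>x. x \<in> S2 \<Longrightarrow> f x = (\<Sum>m\<in>orders l. c m * Y l m x)"
  using basis assms unfolding spherical_harmonic_basis_def by meson

lemma Y_orthonormal:
  "m \<in> orders l \<Longrightarrow> m' \<in> orders l' \<Longrightarrow> l2_inner (Y l m) (Y l' m') = (if l = l' \<and> m = m' then 1 else 0)"
  using basis unfolding spherical_harmonic_basis_def by blast

lemma Y_complete:
  "square_integrable f \<Longrightarrow> (\<lambda>N. l2_norm (\<lambda>x. f x - sph_partial_sum Y (\<lambda>_. 1) f N x)) \<longlonglongrightarrow> 0"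
  using basis unfolding spherical_harmonic_basis_def by blast

text \<open>
  All partial sums of the expansion of \<open>f\<close> vanish, so completeness forces the norm of \<open>f\<close> to be zero.
  This identifies continuous functions by their coefficients throughout.
\<close>

lemma zero_if_coefficients_zero:
  assumes f: "continuous_on S2 f" and z: "\<And>l m. m \<in> orders l \<Longrightarrow> l2_inner f (Y l m) = 0"
    and x: "x \<in> S2"
  shows "f x = 0"
proof (rule continuous_l2_norm_zero[OF f _ x])
  have "sph_partial_sum Y (\<lambda>_. 1) f N x = 0" for N x
    unfolding sph_partial_sum_def by (intro sum.neutral ballI) (simp add: z)
  then have "(\<lambda>N. l2_norm f) \<longlonglongrightarrow> 0"
    using Y_complete[OF square_integrable_continuous[OF f]] by simp
  then show "l2_norm f = 0"
    by (simp add: LIMSEQ_const_iff)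
qed

definition degree_part :: "(nat \<Rightarrow> int \<Rightarrow> real) \<Rightarrow> nat \<Rightarrow> real^3 \<Rightarrow> real" where
  "degree_part a l x = (\<Sum>m\<in>orders l. a l m * Y l m x)"

lemma degree_part_continuous [continuous_intros]: "continuous_on S2 (degree_part a l)"
  unfolding degree_part_def by (intro continuous_intros) auto

lemma l2_inner_degree_part:
  "continuous_on S2 \<phi> \<Longrightarrow> l2_inner (degree_part a l) \<phi> = (\<Sum>m\<in>orders l. a l m * l2_inner (Y l m) \<phi>)"
  unfolding degree_part_def by (intro l2_inner_sum) (auto intro: Y_continuous)

lemma l2_inner_degree_part_Y:
  assumes "m \<in> orders k"
  shows "l2_inner (degree_part a l) (Y k m) = (if l = k then a k m else 0)"
proof -
  have "l2_inner (degree_part a l) (Y k m) = (\<Sum>m'\<in>orders l. if m' = m then (if l = k then a k m else 0) else 0)"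
    unfolding l2_inner_degree_part[OF Y_continuous[OF assms]]
    by (intro sum.cong refl) (use assms in \<open>auto simp: Y_orthonormal\<close>)
  also have "\<dots> = (if l = k then a k m else 0)"
    using assms by auto
  finally show ?thesis .
qed

lemma degree_part_orthogonal:
  "l2_inner (degree_part a l) (degree_part b k) = (if l = k then \<Sum>m\<in>orders l. a l m * b l m else 0)"
  by (auto simp: l2_inner_degree_part degree_part_continuous l2_inner_commute[of "Y _ _" "degree_part _ _"]
      l2_inner_degree_part_Y
      intro!: sum.cong sum.neutral)

lemma l2_inner_sum_degree_part:
  assumes "finite B"
  shows "l2_inner (\<lambda>x. \<Sum>l\<in>B. degree_part a l x) (\<lambda>x. \<Sum>l\<in>B. degree_part a l x) = (\<Sum>l\<in>B. \<Sum>m\<in>orders l. (a l m)\<^sup>2)"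
proof -
  have c: "continuous_on S2 (\<lambda>x. \<Sum>l\<in>B. degree_part a l x)"
    by (intro continuous_intros)
  have "l2_inner (degree_part a l) (\<lambda>x. \<Sum>l\<in>B. degree_part a l x) = (\<Sum>m\<in>orders l. (a l m)\<^sup>2)" if "l \<in> B" for l
    using that assms
    by (subst l2_inner_commute, subst l2_inner_sum')
       (auto intro: degree_part_continuous simp: degree_part_orthogonal power2_eq_square)
  then show ?thesis
    by (subst l2_inner_sum') (auto intro: degree_part_continuous c)
qed

text \<open>
  The kernel of the orthogonal projection onto the spherical harmonics of degree \<open>l\<close>. By the addition
  theorem it is \<open>(2 l + 1) / (4 \<pi>)\<close> times the Legendre polynomial of degree \<open>l\<close> at \<open>\<langle>u, v\<rangle>\<close>.
\<close>

definition degree_kernel :: "nat \<Rightarrow> real^3 \<Rightarrow> real^3 \<Rightarrow> real" where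
  "degree_kernel l u v = (\<Sum>m\<in>orders l. Y l m u * Y l m v)"

lemma degree_kernel_eq_degree_part: "degree_kernel l u = degree_part (\<lambda>l m. Y l m u) l"
  by (simp add: degree_kernel_def degree_part_def fun_eq_iff)

lemma degree_kernel_continuous [continuous_intros]: "continuous_on S2 (degree_kernel l u)"
  unfolding degree_kernel_eq_degree_part by (rule degree_part_continuous)

text \<open>
  Pairing either side, as a function of \<open>v\<close>, with a spherical harmonic of degree \<open>l\<close> evaluates
  that harmonic at \<open>u\<close>: for the reflected kernel, move the reflection to the other factor, which stays
  a harmonic of the same degree, and use that reflecting twice is the identity. So the two sides have the same
  coefficients.
\<close>

lemma degree_kernel_reflect:
  assumes u: "u \<in> S2" and v: "v \<in> S2"
  shows "degree_kernel l (reflect a u) (reflect a v) = degree_kernel l u v"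
proof -
  have cr: "continuous_on S2 (\<lambda>x. f (reflect a x))" if "continuous_on S2 f" for f :: "real^3 \<Rightarrow> real"
    by (rule continuous_on_compose2[OF that])
       (auto intro: linear_continuous_on bounded_linear_reflect)
  let ?F = "\<lambda>x. degree_kernel l (reflect a u) (reflect a x) - degree_kernel l u x"
  have "?F v = 0"
  proof (rule zero_if_coefficients_zero[OF _ _ v])
    show "continuous_on S2 ?F"
      by (intro continuous_intros cr[OF degree_kernel_continuous])
    fix k m assume m: "m \<in> orders k"
    obtain c where c: "\<And>x. x \<in> S2 \<Longrightarrow> Y k m (reflect a x) = (\<Sum>j\<in>orders k. c j * Y k j x)"
      using Y_span[OF spherical_harmonic_reflect[OF Y_harmonic[OF m]]] by blast
    have cT: "Y k m (reflect a x) = degree_part (\<lambda>_. c) k x" if "x \<in> S2" for x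
      unfolding degree_part_def by (rule c[OF that])
    have "l2_inner (\<lambda>x. degree_kernel l (reflect a u) (reflect a x)) (Y k m) =
        l2_inner (degree_kernel l (reflect a u)) (\<lambda>x. Y k m (reflect a x))"
    proof -
      have "(\<lambda>x. degree_kernel l (reflect a u) x * Y k m (reflect a x)) \<in> borel_measurable surface_measure"
        by (intro surface_measurable_continuous continuous_intros cr[OF Y_continuous[OF m]])
      from integral_surface_reflect[OF this, of a] show ?thesis
        by (simp add: l2_inner_def)
    qed
    also have "\<dots> = l2_inner (degree_kernel l (reflect a u)) (degree_part (\<lambda>_. c) k)"
      by (rule l2_inner_cong) (simp_all add: cT)
    also have "\<dots> = (if l = k then degree_part (\<lambda>_. c) k (reflect a u) else 0)"
      unfolding degree_kernel_eq_degree_part degree_part_orthogonal by (simp add: degree_part_def mult.commute)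
    also have "\<dots> = (if l = k then Y k m u else 0)"
      using cT[of "reflect a u"] u by simp
    also have "\<dots> = l2_inner (degree_kernel l u) (Y k m)"
      by (simp add: degree_kernel_eq_degree_part l2_inner_degree_part_Y[OF m])
    finally show "l2_inner ?F (Y k m) = 0"
      by (simp add: l2_inner_diff[OF cr[OF degree_kernel_continuous] degree_kernel_continuous Y_continuous[OF m]])
  qed
  then show ?thesis by simp
qed

lemma degree_kernel_zonal:
  assumes "u \<in> S2" "v \<in> S2" "u' \<in> S2" "v' \<in> S2" "inner u v = inner u' v'"
  shows "degree_kernel l u v = degree_kernel l u' v'"
proof -
  obtain a b where ab: "reflect b (reflect a u) = u'" "reflect b (reflect a v) = v'"
    by (rule two_reflections_move_pair[of u u' v v']) (use assms in auto)
  have "degree_kernel l (reflect b (reflect a u)) (reflect b (reflect a v)) = degree_kernel l u v"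
    using assms by (simp add: degree_kernel_reflect)
  then show ?thesis by (simp add: ab)
qed

abbreviation area :: real where "area \<equiv> measure surface_measure S2"

text \<open>
  By \<open>degree_kernel_zonal\<close> the diagonal values are constant, and their integral is the number of basis
  functions of degree \<open>l\<close>.
\<close>

lemma degree_kernel_diagonal:
  assumes u: "u \<in> S2"
  shows "degree_kernel l u u * area = 2 * real l + 1"
proof -
  have "integral\<^sup>L surface_measure (\<lambda>x. degree_kernel l x x) = integral\<^sup>L surface_measure (\<lambda>x. degree_kernel l u u)"
    by (rule Bochner_Integration.integral_cong) (use u in \<open>auto intro!: degree_kernel_zonal simp: dot_square_norm\<close>)
  then have "degree_kernel l u u * area = integral\<^sup>L surface_measure (\<lambda>x. degree_kernel l x x)"
    by simp
  also have "\<dots> = (\<Sum>m\<in>orders l. l2_inner (Y l m) (Y l m))"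
    unfolding degree_kernel_def l2_inner_def
    by (intro Bochner_Integration.integral_sum surface_integrable_continuous continuous_intros) auto
  also have "\<dots> = (\<Sum>m\<in>orders l. 1)"
    by (intro sum.cong) (auto simp: Y_orthonormal)
  also have "\<dots> = 2 * real l + 1" by simp
  finally show ?thesis .
qed

text \<open>
  For \<open>l = 0\<close> the product of the area with a diagonal value is \<open>1\<close>.
\<close>

lemma area_pos: "area > 0"
proof -
  obtain u :: "real^3" where "u \<in> S2"
    using vector_choose_size[of 1] by auto
  from degree_kernel_diagonal[OF this, of 0] have "area \<noteq> 0" by auto
  then show ?thesis by (simp add: order_less_le)
qed

lemma degree_kernel_diagonal': "u \<in> S2 \<Longrightarrow> degree_kernel l u u = (2 * real l + 1) / area"
  using degree_kernel_diagonal[of u l] area_pos by (simp add: field_simps)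

lemma degree_part_bound:
  assumes "x \<in> S2"
  shows "\<bar>degree_part a l x\<bar> \<le> sqrt (\<Sum>m\<in>orders l. (a l m)\<^sup>2) * sqrt ((2 * real l + 1) / area)"
proof -
  have "(degree_part a l x)\<^sup>2 \<le> (\<Sum>m\<in>orders l. (a l m)\<^sup>2) * (\<Sum>m\<in>orders l. (Y l m x)\<^sup>2)"
    unfolding degree_part_def by (rule Cauchy_Schwarz_ineq_sum)
  also have "(\<Sum>m\<in>orders l. (Y l m x)\<^sup>2) = (2 * real l + 1) / area"
    using degree_kernel_diagonal'[OF assms, of l] by (simp add: degree_kernel_def power2_eq_square)
  finally have "sqrt ((degree_part a l x)\<^sup>2) \<le> sqrt ((\<Sum>m\<in>orders l. (a l m)\<^sup>2) * ((2 * real l + 1) / area))"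
    by (rule real_sqrt_le_mono)
  then show ?thesis by (simp only: real_sqrt_abs real_sqrt_mult)
qed

section \<open>Uniformly convergent expansions\<close>

text \<open>
  By \<open>degree_part_bound\<close>, the majorant that makes the expansion with coefficients \<open>a\<close> converge uniformly
  on the sphere.
\<close>

definition abs_convergent :: "(nat \<Rightarrow> int \<Rightarrow> real) \<Rightarrow> bool" where
  "abs_convergent a \<longleftrightarrow> summable (\<lambda>l. sqrt (\<Sum>m\<in>orders l. (a l m)\<^sup>2) * sqrt (2 * real l + 1))"

lemma uniform_limit_degree_part:
  assumes "abs_convergent a"
  shows "uniform_limit S2 (\<lambda>N x. \<Sum>l<N. degree_part a l x) (\<lambda>x. \<Sum>l. degree_part a l x) sequentially"
proof (rule Weierstrass_m_test)
  show "norm (degree_part a l x) \<le> (sqrt (\<Sum>m\<in>orders l. (a l m)\<^sup>2) * sqrt (2 * real l + 1)) / sqrt area" if "x \<in> S2" for l x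
    using degree_part_bound[OF that, of a l] by (simp add: real_sqrt_divide)
  show "summable (\<lambda>l. (sqrt (\<Sum>m\<in>orders l. (a l m)\<^sup>2) * sqrt (2 * real l + 1)) / sqrt area)"
    using assms unfolding abs_convergent_def by (rule summable_divide)
qed

lemma degree_part_sums:
  assumes "abs_convergent a" "x \<in> S2"
  shows "(\<lambda>l. degree_part a l x) sums (\<Sum>l. degree_part a l x)"
  unfolding sums_def using tendsto_uniform_limitI[OF uniform_limit_degree_part[OF assms(1)] assms(2)] .

lemma continuous_suminf_degree_part:
  assumes "abs_convergent a"
  shows "continuous_on S2 (\<lambda>x. \<Sum>l. degree_part a l x)"
  by (rule uniform_limit_theorem[OF _ uniform_limit_degree_part[OF assms]])
     (auto intro!: always_eventually continuous_intros)

lemma l2_inner_suminf_degree_part: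
  assumes a: "abs_convergent a" and \<phi>: "continuous_on S2 \<phi>"
  shows "(\<lambda>l. \<Sum>m\<in>orders l. a l m * l2_inner (Y l m) \<phi>) sums l2_inner (\<lambda>x. \<Sum>l. degree_part a l x) \<phi>"
proof -
  have "(\<lambda>N. l2_inner (\<lambda>x. \<Sum>l<N. degree_part a l x) \<phi>) \<longlonglongrightarrow> l2_inner (\<lambda>x. \<Sum>l. degree_part a l x) \<phi>"
    by (rule l2_inner_uniform_limit[OF uniform_limit_degree_part[OF a] _ \<phi>]) (intro continuous_intros)
  moreover have "l2_inner (\<lambda>x. \<Sum>l<N. degree_part a l x) \<phi> = (\<Sum>l<N. \<Sum>m\<in>orders l. a l m * l2_inner (Y l m) \<phi>)" for N
    by (subst l2_inner_sum') (auto intro: degree_part_continuous simp: l2_inner_degree_part \<phi>)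
  ultimately show ?thesis by (simp add: sums_def)
qed

lemma coefficient_suminf_degree_part:
  assumes a: "abs_convergent a" and m: "m \<in> orders k"
  shows "l2_inner (\<lambda>x. \<Sum>l. degree_part a l x) (Y k m) = a k m"
proof -
  have "(\<lambda>l. \<Sum>j\<in>orders l. a l j * l2_inner (Y l j) (Y k m)) sums l2_inner (\<lambda>x. \<Sum>l. degree_part a l x) (Y k m)"
    by (rule l2_inner_suminf_degree_part[OF a Y_continuous[OF m]])
  moreover have "(\<Sum>j\<in>orders l. a l j * l2_inner (Y l j) (Y k m)) = (if l = k then a k m else 0)" for l
    using l2_inner_degree_part[OF Y_continuous[OF m], of a l] l2_inner_degree_part_Y[OF m, of a l] by simp
  ultimately have "(\<lambda>l. if l = k then a k m else 0) sums l2_inner (\<lambda>x. \<Sum>l. degree_part a l x) (Y k m)"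
    by simp
  moreover have "(\<lambda>l. if l = k then a k m else 0) sums a k m"
    using sums_single[of k "\<lambda>_. a k m"] by simp
  ultimately show ?thesis by (rule sums_unique2)
qed

lemma eq_suminf_degree_part:
  assumes f: "continuous_on S2 f" and a: "abs_convergent (\<lambda>l m. l2_inner f (Y l m))" and x: "x \<in> S2"
  shows "f x = (\<Sum>l. degree_part (\<lambda>l m. l2_inner f (Y l m)) l x)"
proof -
  let ?F = "\<lambda>x. \<Sum>l. degree_part (\<lambda>l m. l2_inner f (Y l m)) l x"
  have "f x - ?F x = 0"
  proof (rule zero_if_coefficients_zero[OF _ _ x, where f = "\<lambda>x. f x - ?F x"])
    show "continuous_on S2 (\<lambda>x. f x - ?F x)"
      by (intro continuous_intros f continuous_suminf_degree_part[OF a])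
    fix l m assume m: "m \<in> orders l"
    show "l2_inner (\<lambda>x. f x - ?F x) (Y l m) = 0"
      unfolding l2_inner_diff[OF f continuous_suminf_degree_part[OF a] Y_continuous[OF m]]
      by (simp add: coefficient_suminf_degree_part[OF a m])
  qed
  then show ?thesis by simp
qed

end

section \<open>Sobolev functions and Green functions\<close>

lemma sobolev_weight_bounds:
  assumes "p \<ge> 0"
  shows "(1 + real l) powr (2 * p) \<le> 2 powr p * (1 + real l * (real l + 1)) powr p"
    and "(1 + real l * (real l + 1)) powr p \<le> (1 + real l) powr (2 * p)"
proof -
  have eq: "(1 + real l) powr (2 * p) = ((1 + real l)\<^sup>2) powr p"
    by (simp add: powr_powr flip: powr_numeral)
  have "((1 + real l)\<^sup>2) powr p \<le> (2 * (1 + real l * (real l + 1))) powr p"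
    by (rule powr_mono2[OF assms]) (auto simp: power2_eq_square algebra_simps)
  then show "(1 + real l) powr (2 * p) \<le> 2 powr p * (1 + real l * (real l + 1)) powr p"
    by (simp add: eq powr_mult del: distrib_left_numeral)
  show "(1 + real l * (real l + 1)) powr p \<le> (1 + real l) powr (2 * p)"
    unfolding eq by (rule powr_mono2[OF assms]) (auto simp: power2_eq_square algebra_simps)
qed

lemma summable_dimension_powr:
  assumes "s > 2"
  shows "summable (\<lambda>l. (2 * real l + 1) * (1 + real l) powr - s)"
proof (rule summable_comparison_test'[where N = 0])
  have "summable (\<lambda>l. real (Suc l) powr (1 - s))"
    unfolding summable_Suc_iff[of "\<lambda>l. real l powr (1 - s)"] summable_real_powr_iff using assms by simp
  then show "summable (\<lambda>l. 2 * real (Suc l) powr (1 - s))"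
    by (rule summable_mult)
  fix l :: nat
  have "(2 * real l + 1) * (1 + real l) powr - s \<le> (2 * (1 + real l)) * (1 + real l) powr - s"
    by (intro mult_right_mono) auto
  also have "\<dots> = 2 * ((1 + real l) powr 1 * (1 + real l) powr - s)"
    by simp
  also have "\<dots> = 2 * real (Suc l) powr (1 - s)"
    by (simp only: powr_add[symmetric]) (simp add: add.commute)
  finally show "norm ((2 * real l + 1) * (1 + real l) powr - s) \<le> 2 * real (Suc l) powr (1 - s)"
    by simp
qed

text \<open>
  The first bound makes the Green functions converge and puts them into the Sobolev space, the second makes
  \<open>\<parallel>D f\<parallel>\<close> finite on that space.
\<close>

lemma admissible_square_bounds:
  assumes "admissible p D"
  obtains c C where "c > 0" "C > 0"
    "\<And>l. (1 + real l) powr (2 * p) \<le> c * (D l)\<^sup>2"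
    "\<And>l. (D l)\<^sup>2 \<le> C * (1 + real l * (real l + 1)) powr p"
proof -
  obtain C1 C2 where C: "p \<ge> 0" "C1 > 0" "C2 > 0" "\<And>l. C1 * (1 + real l) powr p \<le> \<bar>D l\<bar>"
    "\<And>l. \<bar>D l\<bar> \<le> C2 * (1 + real l) powr p"
    using assms unfolding admissible_def by blast
  have sq: "(1 + real l) powr (2 * p) = ((1 + real l) powr p)\<^sup>2" for l
    by (simp add: powr_power mult.commute)
  show ?thesis
  proof
    show "inverse (C1\<^sup>2) > 0" "C2\<^sup>2 * 2 powr p > 0" using C by auto
    fix l
    have "(C1 * (1 + real l) powr p)\<^sup>2 \<le> \<bar>D l\<bar>\<^sup>2"
      using C by (intro power_mono) auto
    then show "(1 + real l) powr (2 * p) \<le> inverse (C1\<^sup>2) * (D l)\<^sup>2"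
      using C(2) unfolding sq by (simp add: field_simps power_mult_distrib)
    have "\<bar>D l\<bar>\<^sup>2 \<le> (C2 * (1 + real l) powr p)\<^sup>2"
      using C by (intro power_mono) auto
    also have "\<dots> = C2\<^sup>2 * (1 + real l) powr (2 * p)"
      by (simp only: sq power_mult_distrib)
    also have "\<dots> \<le> C2\<^sup>2 * (2 powr p * (1 + real l * (real l + 1)) powr p)"
      by (intro mult_left_mono sobolev_weight_bounds C) auto
    finally show "(D l)\<^sup>2 \<le> C2\<^sup>2 * 2 powr p * (1 + real l * (real l + 1)) powr p"
      by simp
  qed
qed

text \<open>
  The inverse of \<open>D\<^sup>* D\<close> has finite trace: its eigenvalue \<open>1 / D\<^sub>l\<^sup>2\<close> has multiplicity \<open>2 l + 1\<close> and
  decays like \<open>l\<close> to the power \<open>- 2 p\<close>, so that \<open>p > 1\<close> is the condition for convergence.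
\<close>

lemma summable_dimension_over_square:
  assumes "p > 1" "admissible p D"
  shows "summable (\<lambda>l. (2 * real l + 1) / (D l)\<^sup>2)"
proof -
  obtain c where c: "c > 0" "\<And>l. (1 + real l) powr (2 * p) \<le> c * (D l)\<^sup>2"
    using admissible_square_bounds[OF assms(2)] by metis
  have D: "D l \<noteq> 0" for l using assms(2) by (simp add: admissible_def)
  show ?thesis
  proof (rule summable_comparison_test'[where N = 0])
    show "summable (\<lambda>l. c * ((2 * real l + 1) * (1 + real l) powr - (2 * p)))"
      by (rule summable_mult[OF summable_dimension_powr]) (use assms in simp)
    fix l
    have "1 / (D l)\<^sup>2 \<le> c * (1 + real l) powr - (2 * p)"
      using c(2)[of l] D[of l] by (simp add: powr_minus field_simps)
    then have "(2 * real l + 1) * (1 / (D l)\<^sup>2) \<le> (2 * real l + 1) * (c * (1 + real l) powr - (2 * p))"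
      by (rule mult_left_mono) simp
    then show "norm ((2 * real l + 1) / (D l)\<^sup>2) \<le> c * ((2 * real l + 1) * (1 + real l) powr - (2 * p))"
      by (simp add: mult_ac)
  qed
qed

context spherical_basis
begin

abbreviation hat :: "(real^3 \<Rightarrow> real) \<Rightarrow> nat \<Rightarrow> int \<Rightarrow> real" where
  "hat f l m \<equiv> l2_inner f (Y l m)"

text \<open>
  The Sobolev embedding into continuous functions: the arithmetic-geometric mean inequality splits the majorant into the
  Sobolev norm and the convergent series \<open>\<Sum> (2 l + 1) / w\<^sub>l\<close> over the Sobolev weights \<open>w\<^sub>l\<close>.
\<close>

lemma sobolev_abs_convergent:
  assumes p: "p > 1" and f: "f \<in> sobolev Y p"
  shows "abs_convergent (hat f)"
  unfolding abs_convergent_def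
proof (rule summable_comparison_test'[where N = 0])
  let ?w = "\<lambda>l. (1 + real l * (real l + 1)) powr p"
  let ?A = "\<lambda>l. \<Sum>m\<in>orders l. (hat f l m)\<^sup>2"
  let ?g = "\<lambda>l. (?w l * ?A l + 2 powr p * ((2 * real l + 1) * (1 + real l) powr - (2 * p))) / 2"
  show "summable ?g"
    using f p by (intro summable_divide summable_add summable_mult summable_dimension_powr)
      (auto simp: sobolev_def)
  fix l
  have "1 + real l * (real l + 1) > 0"
    by (intro add_pos_nonneg) auto
  then have pos: "?w l > 0" by simp
  have A: "?A l \<ge> 0" by (simp add: sum_nonneg)
  have le: "1 / ?w l \<le> 2 powr p * (1 + real l) powr - (2 * p)"
    using sobolev_weight_bounds(1)[of p l] p pos by (simp add: powr_minus field_simps)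
  have "sqrt (?A l) * sqrt (2 * real l + 1) = sqrt ((?w l * ?A l) * ((2 * real l + 1) / ?w l))"
    using pos by (simp flip: real_sqrt_mult)
  also have "\<dots> \<le> (?w l * ?A l + (2 * real l + 1) / ?w l) / 2"
    using pos A by (intro arith_geo_mean_sqrt) auto
  also have "\<dots> \<le> ?g l"
  proof -
    have "(2 * real l + 1) / ?w l \<le> 2 powr p * ((2 * real l + 1) * (1 + real l) powr - (2 * p))"
      using mult_left_mono[OF le, of "2 * real l + 1"] by (simp add: mult_ac)
    then show ?thesis
      by (intro divide_right_mono add_left_mono) auto
  qed
  finally show "norm (sqrt (?A l) * sqrt (2 * real l + 1)) \<le> ?g l"
    using A by simp
qed

lemma sobolev_pointwise:
  assumes "p > 1" "f \<in> sobolev_cont Y p" "x \<in> S2"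
  shows "(\<lambda>l. degree_part (hat f) l x) sums f x"
proof -
  have f: "f \<in> sobolev Y p" "continuous_on S2 f"
    using assms(2) by (auto simp: sobolev_cont_def)
  note a = sobolev_abs_convergent[OF assms(1) f(1)]
  show ?thesis
    using degree_part_sums[OF a assms(3)] eq_suminf_degree_part[OF f(2) a assms(3)] by simp
qed

text \<open>
  Parseval's identity for \<open>D f\<close>. The partial sums are Cauchy in \<open>L\<^sup>2\<close>, so the choice in the definition of
  \<open>sph_op\<close> has a witness; the norm of any witness is the limit of the norms of the partial sums.
\<close>

lemma sph_op_norm_sums:
  assumes sm: "summable (\<lambda>l. \<Sum>m\<in>orders l. (D l * hat f l m)\<^sup>2)"
  shows "(\<lambda>l. \<Sum>m\<in>orders l. (D l * hat f l m)\<^sup>2) sums (l2_norm (sph_op Y D f))\<^sup>2"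
proof -
  define a where "a l m = D l * hat f l m" for l m
  let ?c = "\<lambda>l. \<Sum>m\<in>orders l. (a l m)\<^sup>2"
  let ?S = "sph_partial_sum Y D f"
  have S: "?S N = (\<lambda>x. \<Sum>l<N. degree_part a l x)" for N
    by (simp add: fun_eq_iff sph_partial_sum_def degree_part_def a_def sum_distrib_left mult.assoc)
  have Sc: "continuous_on S2 (?S N)" for N
    unfolding S by (intro continuous_intros)
  have Sm: "?S N \<in> borel_measurable surface_measure" for N
    by (rule surface_measurable_continuous[OF Sc])
  have Si: "integrable surface_measure (\<lambda>x. (?S N x)\<^sup>2)" for N
    by (intro surface_integrable_continuous continuous_intros Sc)
  have diff: "integral\<^sup>L surface_measure (\<lambda>x. (?S M x - ?S N x)\<^sup>2) = (\<Sum>l\<in>{N..<M}. ?c l)"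
    if "N \<le> M" for N M
  proof -
    have "?S M x - ?S N x = (\<Sum>l\<in>{N..<M}. degree_part a l x)" for x
      unfolding S using that by (simp add: sum_diff_nat_ivl lessThan_atLeast0)
    then show ?thesis
      using l2_inner_sum_degree_part[of "{N..<M}" a] by (simp add: l2_inner_def power2_eq_square)
  qed
  have norm_S: "l2_inner (?S N) (?S N) = (\<Sum>l<N. ?c l)" for N
    unfolding S by (rule l2_inner_sum_degree_part) simp
  have cauchy: "\<exists>N. \<forall>m\<ge>N. \<forall>k\<ge>N. integral\<^sup>L surface_measure (\<lambda>x. (?S m x - ?S k x)\<^sup>2) < e" if "e > 0" for e
  proof -
    obtain N where N: "\<And>m k. m \<ge> N \<Longrightarrow> norm (sum ?c {m..<k}) < e"
      using sm \<open>e > 0\<close> unfolding summable_Cauchy a_def by blast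
    have *: "integral\<^sup>L surface_measure (\<lambda>x. (?S k x - ?S m x)\<^sup>2) < e" if "N \<le> m" "m \<le> k" for m k
      unfolding diff[OF that(2)] using N[OF that(1), of k] by (simp add: abs_less_iff)
    show ?thesis
    proof (intro exI allI impI)
      fix m k assume "m \<ge> N" "k \<ge> N"
      then show "integral\<^sup>L surface_measure (\<lambda>x. (?S m x - ?S k x)\<^sup>2) < e"
        using *[of m k] *[of k m] by (cases "m \<le> k") (auto simp: power2_commute[of "?S m _"])
    qed
  qed
  obtain g where g: "g \<in> borel_measurable surface_measure" "integrable surface_measure (\<lambda>x. (g x)\<^sup>2)"
    "(\<lambda>N. integral\<^sup>L surface_measure (\<lambda>x. (g x - ?S N x)\<^sup>2)) \<longlonglongrightarrow> 0"
    using surface.L2_complete[of ?S, OF Sm Si cauchy] by blast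
  have "(\<lambda>N. l2_norm (\<lambda>x. g x - ?S N x)) \<longlonglongrightarrow> 0"
    using tendsto_real_sqrt[OF g(3)] by (simp add: l2_norm_def l2_inner_def power2_eq_square)
  with g(1,2) have "\<exists>g. square_integrable g \<and> (\<lambda>N. l2_norm (\<lambda>x. g x - ?S N x)) \<longlonglongrightarrow> 0"
    by (auto simp: square_integrable_def)
  from someI_ex[OF this]
  have h: "square_integrable (sph_op Y D f)" "(\<lambda>N. l2_norm (\<lambda>x. sph_op Y D f x - ?S N x)) \<longlonglongrightarrow> 0"
    unfolding sph_op_def by auto
  define h where "h = sph_op Y D f"
  have hm: "h \<in> borel_measurable surface_measure" and hi: "integrable surface_measure (\<lambda>x. (h x)\<^sup>2)"
    using h(1) by (auto simp: square_integrable_def h_def)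
  \<comment> \<open>With \<open>S = h - r\<close>, the square norm of \<open>S\<close> is that of \<open>h\<close> up to terms that tend to zero with \<open>r\<close>.\<close>
  define r where "r N x = h x - ?S N x" for N x
  have rm: "r N \<in> borel_measurable surface_measure" for N
    unfolding r_def using hm Sm by measurable
  have ri: "integrable surface_measure (\<lambda>x. (r N x)\<^sup>2)" for N
    unfolding r_def using integrable_square_add[of h surface_measure "\<lambda>x. - ?S N x"] hm hi Sm Si by simp
  let ?E = "\<lambda>N. integral\<^sup>L surface_measure (\<lambda>x. (r N x)\<^sup>2)"
  let ?H = "integral\<^sup>L surface_measure (\<lambda>x. (h x)\<^sup>2)"
  let ?X = "\<lambda>N. integral\<^sup>L surface_measure (\<lambda>x. h x * r N x)"
  have "(\<lambda>N. (l2_norm (r N))\<^sup>2) \<longlonglongrightarrow> 0\<^sup>2"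
    using tendsto_power[OF h(2), of 2] by (simp add: r_def[abs_def] h_def)
  then have E: "?E \<longlonglongrightarrow> 0"
    unfolding l2_norm_square by (simp add: l2_inner_def power2_eq_square)
  have "(\<lambda>N. (?X N)\<^sup>2) \<longlonglongrightarrow> 0"
  proof (rule tendsto_sandwich[of "\<lambda>_. 0" _ _ "\<lambda>N. ?H * ?E N"])
    show "(\<lambda>N. ?H * ?E N) \<longlonglongrightarrow> 0"
      using tendsto_mult_right_zero[OF E] by simp
    show "\<forall>\<^sub>F N in sequentially. (?X N)\<^sup>2 \<le> ?H * ?E N"
      using integral_Cauchy_Schwarz[OF hm rm hi ri] by simp
  qed auto
  then have X: "?X \<longlonglongrightarrow> 0"
    using tendsto_real_sqrt[of "\<lambda>N. (?X N)\<^sup>2" 0] tendsto_rabs_zero_iff[of ?X] by simp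
  have "l2_inner (?S N) (?S N) = ?H - 2 * ?X N + ?E N" for N
  proof -
    have "l2_inner (?S N) (?S N) = integral\<^sup>L surface_measure (\<lambda>x. (h x)\<^sup>2 - 2 * (h x * r N x) + (r N x)\<^sup>2)"
      unfolding l2_inner_def r_def
      by (intro arg_cong[where f = "integral\<^sup>L surface_measure"]) (auto simp: power2_eq_square algebra_simps)
    also have "\<dots> = ?H - 2 * ?X N + ?E N"
      using hi ri[of N] integrable_mult_of_squares[OF hm rm hi ri, of N] by simp
    finally show ?thesis .
  qed
  moreover have "(\<lambda>N. ?H - 2 * ?X N + ?E N) \<longlonglongrightarrow> ?H - 2 * 0 + 0"
    by (intro tendsto_intros X E)
  ultimately have "(\<lambda>N. \<Sum>l<N. ?c l) \<longlonglongrightarrow> ?H"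
    by (simp add: norm_S)
  moreover have "?H = (l2_norm (sph_op Y D f))\<^sup>2"
    unfolding l2_norm_square by (simp add: l2_inner_def h_def power2_eq_square)
  ultimately show ?thesis
    by (simp add: sums_def a_def)
qed

lemma sobolev_sph_op_norm_sums:
  assumes D: "admissible p D" and f: "f \<in> sobolev Y p"
  shows "(\<lambda>l. \<Sum>m\<in>orders l. (D l * hat f l m)\<^sup>2) sums (l2_norm (sph_op Y D f))\<^sup>2"
proof (rule sph_op_norm_sums)
  obtain C where C: "C > 0" "\<And>l. (D l)\<^sup>2 \<le> C * (1 + real l * (real l + 1)) powr p"
    using admissible_square_bounds[OF D] by metis
  let ?A = "\<lambda>l. \<Sum>m\<in>orders l. (hat f l m)\<^sup>2"
  show "summable (\<lambda>l. \<Sum>m\<in>orders l. (D l * hat f l m)\<^sup>2)"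
  proof (rule summable_comparison_test'[where N = 0])
    show "summable (\<lambda>l. C * ((1 + real l * (real l + 1)) powr p * ?A l))"
      using f by (intro summable_mult) (auto simp: sobolev_def)
    fix l
    have "(\<Sum>m\<in>orders l. (D l * hat f l m)\<^sup>2) = (D l)\<^sup>2 * ?A l"
      by (simp add: power_mult_distrib sum_distrib_left)
    also have "\<dots> \<le> C * (1 + real l * (real l + 1)) powr p * ?A l"
      by (intro mult_right_mono C) (simp add: sum_nonneg)
    finally show "norm (\<Sum>m\<in>orders l. (D l * hat f l m)\<^sup>2) \<le> C * ((1 + real l * (real l + 1)) powr p * ?A l)"
      by (simp add: sum_nonneg mult.assoc)
  qed
qed

lemma green_abs_convergent:
  assumes E: "summable (\<lambda>l. (2 * real l + 1) / \<bar>E l\<bar>)" and u: "u \<in> S2"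
  shows "abs_convergent (\<lambda>l m. Y l m u / E l)"
proof -
  have "sqrt (\<Sum>m\<in>orders l. (Y l m u / E l)\<^sup>2) * sqrt (2 * real l + 1) = ((2 * real l + 1) / \<bar>E l\<bar>) / sqrt area" for l
  proof -
    have "(\<Sum>m\<in>orders l. (Y l m u / E l)\<^sup>2) = degree_kernel l u u / (E l)\<^sup>2"
      by (simp add: degree_kernel_def power_divide power2_eq_square sum_divide_distrib)
    also have "\<dots> = (2 * real l + 1) / area / (E l)\<^sup>2"
      by (simp add: degree_kernel_diagonal'[OF u])
    finally show ?thesis
      by (simp add: real_sqrt_divide real_sqrt_mult)
  qed
  then show ?thesis
    unfolding abs_convergent_def using summable_divide[OF E] by simp
qed

text \<open>
  Two continuous functions that represent the same distribution have the same coefficients, since spherical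
  harmonics are test functions.
\<close>

lemma green_function_eq:
  assumes E: "summable (\<lambda>l. (2 * real l + 1) / \<bar>E l\<bar>)" and u: "u \<in> S2"
  shows "green_function Y E u = (\<lambda>v\<in>S2. \<Sum>l. degree_part (\<lambda>l m. Y l m u / E l) l v)"
    (is "_ = restrict ?F S2")
proof -
  note a = green_abs_convergent[OF E u]
  have rF: "l2_inner (restrict ?F S2) \<phi> = l2_inner ?F \<phi>" for \<phi>
    by (rule l2_inner_cong) auto
  have ex: "restrict ?F S2 \<in> extensional S2 \<and> continuous_on S2 (restrict ?F S2) \<and>
     (\<forall>\<phi>. smooth_on_S2 \<phi> \<longrightarrow> l2_inner (restrict ?F S2) \<phi> = sph_op_inv Y E (dirac u) \<phi>)"
  proof (intro conjI allI impI)
    show "continuous_on S2 (restrict ?F S2)"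
      by (rule continuous_on_eq[OF continuous_suminf_degree_part[OF a]]) simp
    fix \<phi> assume "smooth_on_S2 \<phi>"
    then have "continuous_on S2 \<phi>" by (rule smooth_on_S2_continuous)
    from l2_inner_suminf_degree_part[OF a this]
    show "l2_inner (restrict ?F S2) \<phi> = sph_op_inv Y E (dirac u) \<phi>"
      unfolding rF sph_op_inv_def dirac_def
      by (simp add: sums_unique sum_distrib_left)
  qed simp
  show ?thesis
    unfolding green_function_def
  proof (rule the_equality, goal_cases)
    case 1
    show ?case by (rule ex)
  next
    case (2 f)
    then have f: "f \<in> extensional S2 \<and> continuous_on S2 f \<and>
      (\<forall>\<phi>. smooth_on_S2 \<phi> \<longrightarrow> l2_inner f \<phi> = sph_op_inv Y E (dirac u) \<phi>)" .
    have "f v - restrict ?F S2 v = 0" if "v \<in> S2" for v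
    proof (rule zero_if_coefficients_zero[OF _ _ that, where f = "\<lambda>v. f v - restrict ?F S2 v"])
      show "continuous_on S2 (\<lambda>v. f v - restrict ?F S2 v)"
        using f ex by (intro continuous_intros) auto
      fix l m assume m: "m \<in> orders l"
      then show "l2_inner (\<lambda>v. f v - restrict ?F S2 v) (Y l m) = 0"
        using f ex spherical_harmonic_smooth[OF Y_harmonic[OF m]]
        by (subst l2_inner_diff) (auto intro: Y_continuous)
    qed
    then show ?case
      using f by (intro extensionalityI[of _ S2]) auto
  qed
qed

lemma green_function_kernel_sums:
  assumes E: "summable (\<lambda>l. (2 * real l + 1) / \<bar>E l\<bar>)" and u: "u \<in> S2" and v: "v \<in> S2"
  shows "(\<lambda>l. degree_kernel l u v / E l) sums green_function Y E u v"
proof -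
  have "degree_part (\<lambda>l m. Y l m u / E l) l v = degree_kernel l u v / E l" for l
    by (simp add: degree_part_def degree_kernel_def sum_divide_distrib)
  then show ?thesis
    using degree_part_sums[OF green_abs_convergent[OF E u] v] v
    by (simp add: green_function_eq[OF E u])
qed

text \<open>
  Existence of the kernel is the zonality of each \<open>degree_kernel\<close>. Uniqueness holds because every
  \<open>t \<in> {-1..1}\<close> is an inner product of unit vectors.
\<close>

lemma zonal_green_kernel_inner:
  assumes E: "summable (\<lambda>l. (2 * real l + 1) / \<bar>E l\<bar>)" and u: "u \<in> S2" and v: "v \<in> S2"
  shows "zonal_green_kernel Y E (inner u v) = green_function Y E u v"
proof -
  have zonal: "green_function Y E u v = green_function Y E u' v'"
    if "u \<in> S2" "v \<in> S2" "u' \<in> S2" "v' \<in> S2" "inner u v = inner u' v'" for u v u' v'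
    using green_function_kernel_sums[OF E, of u v] green_function_kernel_sums[OF E, of u' v'] that
      degree_kernel_zonal[OF that] by (simp add: sums_unique2)
  \<comment> \<open>\<open>(e1, z t)\<close> is a pair of unit vectors with inner product \<open>t\<close>.\<close>
  define e1 e2 :: "real^3" where "e1 = axis 1 1" and "e2 = axis 2 1"
  have e: "inner e1 e1 = 1" "inner e2 e2 = 1" "inner e1 e2 = 0" "inner e2 e1 = 0"
    by (simp_all add: e1_def e2_def inner_axis_axis)
  define z where "z t = t *\<^sub>R e1 + sqrt (1 - t\<^sup>2) *\<^sub>R e2" for t
  have z: "z t \<in> S2" "inner e1 (z t) = t" if "t \<in> {-1..1}" for t
  proof -
    have "t\<^sup>2 \<le> 1" using that by (simp add: abs_square_le_1 abs_le_iff)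
    then have "inner (z t) (z t) = 1"
      by (simp add: z_def inner_add_left inner_add_right e power2_eq_square[symmetric])
    then show "z t \<in> S2" by (simp add: norm_eq_1)
    show "inner e1 (z t) = t" by (simp add: z_def inner_add_right e)
  qed
  have e1: "e1 \<in> S2" using e by (simp add: norm_eq_1)
  have range: "inner u v \<in> {-1..1}" if "u \<in> S2" "v \<in> S2" for u v :: "real^3"
    using Cauchy_Schwarz_ineq2[of u v] that by (auto simp: abs_le_iff)
  let ?\<psi> = "restrict (\<lambda>t. green_function Y E e1 (z t)) {-1..1}"
  have ex: "?\<psi> \<in> extensional {-1..1} \<and> (\<forall>u\<in>S2. \<forall>v\<in>S2. green_function Y E u v = ?\<psi> (inner u v))"
  proof (intro conjI ballI)
    fix u v :: "real^3" assume uv: "u \<in> S2" "v \<in> S2"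
    note r = range[OF uv]
    show "green_function Y E u v = ?\<psi> (inner u v)"
      using r zonal[OF uv e1 z(1)[OF r]] z(2)[OF r] by simp
  qed simp
  have "zonal_green_kernel Y E = ?\<psi>"
    unfolding zonal_green_kernel_def
  proof (rule the_equality, goal_cases)
    case 1
    show ?case by (rule ex)
  next
    case (2 \<psi>)
    then have \<psi>: "\<psi> \<in> extensional {-1..1} \<and> (\<forall>u\<in>S2. \<forall>v\<in>S2. green_function Y E u v = \<psi> (inner u v))" .
    show ?case
    proof (rule extensionalityI[of _ "{-1..1}"])
      fix t :: real assume t: "t \<in> {-1..1}"
      have "green_function Y E e1 (z t) = \<psi> (inner e1 (z t))"
        using \<psi> e1 z(1)[OF t] by blast
      then show "\<psi> t = ?\<psi> t" using t by (simp add: z(2)[OF t])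
    qed (use \<psi> in auto)
  qed
  then show ?thesis using ex u v by simp
qed

section \<open>Point evaluation as a pairing with Green functions\<close>

context
  fixes p :: real and D :: "nat \<Rightarrow> real"
  assumes p: "p > 1" and D: "admissible p D"
begin

abbreviation \<psi> :: "real \<Rightarrow> real" where
  "\<psi> \<equiv> zonal_green_kernel Y (\<lambda>l. (D l)\<^sup>2)"

lemma D_nonzero: "D l \<noteq> 0"
  using D by (simp add: admissible_def)

lemma square_summable: "summable (\<lambda>l. (2 * real l + 1) / \<bar>(D l)\<^sup>2\<bar>)"
  using summable_dimension_over_square[OF p D] by simp

lemma \<psi>_green:
  "u \<in> S2 \<Longrightarrow> v \<in> S2 \<Longrightarrow> \<psi> (inner u v) = green_function Y (\<lambda>l. (D l)\<^sup>2) u v"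
  by (rule zonal_green_kernel_inner[OF square_summable])

lemma \<psi>_sums:
  assumes "u \<in> S2" "v \<in> S2"
  shows "(\<lambda>l. degree_kernel l u v / (D l)\<^sup>2) sums \<psi> (inner u v)"
  unfolding \<psi>_green[OF assms] by (rule green_function_kernel_sums[OF square_summable assms])

text \<open>
  The quadratic form is \<open>\<Sum>\<^sub>l\<^sub>m (\<Sum>\<^sub>q c\<^sub>q Y\<^sub>l\<^sub>m(x\<^sub>q))\<^sup>2 / D\<^sub>l\<^sup>2\<close>.
\<close>

lemma gram_nonneg:
  assumes Q: "finite Q" and x: "\<And>q. q \<in> Q \<Longrightarrow> x q \<in> S2"
  shows "0 \<le> (\<Sum>q\<in>Q. \<Sum>q'\<in>Q. c q * c q' * \<psi> (inner (x q) (x q')))"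
proof -
  have "(\<lambda>l. \<Sum>q\<in>Q. \<Sum>q'\<in>Q. c q * c q' * (degree_kernel l (x q) (x q') / (D l)\<^sup>2)) sums
      (\<Sum>q\<in>Q. \<Sum>q'\<in>Q. c q * c q' * \<psi> (inner (x q) (x q')))"
    by (intro sums_sum sums_mult \<psi>_sums x)
  moreover have "(\<Sum>q\<in>Q. \<Sum>q'\<in>Q. c q * c q' * (degree_kernel l (x q) (x q') / (D l)\<^sup>2)) =
      (\<Sum>m\<in>orders l. (\<Sum>q\<in>Q. c q * Y l m (x q))\<^sup>2) / (D l)\<^sup>2" for l
  proof -
    have "(\<Sum>m\<in>orders l. (\<Sum>q\<in>Q. c q * Y l m (x q))\<^sup>2) =
        (\<Sum>m\<in>orders l. \<Sum>q\<in>Q. \<Sum>q'\<in>Q. c q * c q' * (Y l m (x q) * Y l m (x q')))"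
      by (simp add: power2_eq_square sum_product mult_ac)
    also have "\<dots> = (\<Sum>q\<in>Q. \<Sum>m\<in>orders l. \<Sum>q'\<in>Q. c q * c q' * (Y l m (x q) * Y l m (x q')))"
      by (rule sum.swap)
    also have "\<dots> = (\<Sum>q\<in>Q. \<Sum>q'\<in>Q. \<Sum>m\<in>orders l. c q * c q' * (Y l m (x q) * Y l m (x q')))"
      by (intro sum.cong refl sum.swap)
    finally show ?thesis
      by (simp add: degree_kernel_def sum_distrib_left sum_divide_distrib)
  qed
  ultimately have s: "(\<lambda>l. (\<Sum>m\<in>orders l. (\<Sum>q\<in>Q. c q * Y l m (x q))\<^sup>2) / (D l)\<^sup>2) sums
      (\<Sum>q\<in>Q. \<Sum>q'\<in>Q. c q * c q' * \<psi> (inner (x q) (x q')))" by simp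
  show ?thesis
    by (rule sums_le[OF _ sums_zero s]) (simp add: sum_nonneg)
qed

text \<open>
  The solution \<open>\<mu>\<close> of \<open>D\<^sup>* D \<mu> = \<Sum>\<^sub>q c\<^sub>q \<delta>\<close> with the Dirac distributions \<open>\<delta>\<close> at the points \<open>x\<^sub>q\<close>, as a continuous
  representative.
\<close>

definition potential :: "'q set \<Rightarrow> ('q \<Rightarrow> real^3) \<Rightarrow> ('q \<Rightarrow> real) \<Rightarrow> real^3 \<Rightarrow> real" where
  "potential Q x c = (\<lambda>v\<in>S2. \<Sum>q\<in>Q. c q * \<psi> (inner v (x q)))"

lemma potential_green:
  assumes x: "\<And>q. q \<in> Q \<Longrightarrow> x q \<in> S2" and v: "v \<in> S2"
  shows "potential Q x c v = (\<Sum>q\<in>Q. c q * green_function Y (\<lambda>l. (D l)\<^sup>2) (x q) v)"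
  using v x unfolding potential_def
  by (auto intro!: sum.cong simp: \<psi>_green[symmetric] inner_commute)

lemma green_continuous: "u \<in> S2 \<Longrightarrow> continuous_on S2 (green_function Y (\<lambda>l. (D l)\<^sup>2) u)"
  by (rule continuous_on_eq[OF continuous_suminf_degree_part[OF green_abs_convergent[OF square_summable]]])
     (simp_all add: green_function_eq[OF square_summable])

lemma potential_continuous:
  assumes x: "\<And>q. q \<in> Q \<Longrightarrow> x q \<in> S2"
  shows "continuous_on S2 (potential Q x c)"
proof (rule continuous_on_eq)
  show "continuous_on S2 (\<lambda>v. \<Sum>q\<in>Q. c q * green_function Y (\<lambda>l. (D l)\<^sup>2) (x q) v)"
    by (intro continuous_intros green_continuous x)
qed (simp add: potential_green[OF x])

lemma hat_green:
  assumes u: "u \<in> S2" and m: "m \<in> orders l"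
  shows "hat (green_function Y (\<lambda>l. (D l)\<^sup>2) u) l m = Y l m u / (D l)\<^sup>2"
proof -
  have "hat (green_function Y (\<lambda>l. (D l)\<^sup>2) u) l m =
      l2_inner (\<lambda>v. \<Sum>k. degree_part (\<lambda>l m. Y l m u / (D l)\<^sup>2) k v) (Y l m)"
    by (rule l2_inner_cong) (simp_all add: green_function_eq[OF square_summable u])
  then show ?thesis
    by (simp add: coefficient_suminf_degree_part[OF green_abs_convergent[OF square_summable u] m])
qed

lemma hat_potential:
  assumes x: "\<And>q. q \<in> Q \<Longrightarrow> x q \<in> S2" and m: "m \<in> orders l"
  shows "hat (potential Q x c) l m = (\<Sum>q\<in>Q. c q * Y l m (x q)) / (D l)\<^sup>2"
proof -
  have "hat (potential Q x c) l m =
      l2_inner (\<lambda>v. \<Sum>q\<in>Q. c q * green_function Y (\<lambda>l. (D l)\<^sup>2) (x q) v) (Y l m)"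
    by (rule l2_inner_cong) (simp_all add: potential_green[OF x])
  also have "\<dots> = (\<Sum>q\<in>Q. c q * hat (green_function Y (\<lambda>l. (D l)\<^sup>2) (x q)) l m)"
    by (intro l2_inner_sum green_continuous x Y_continuous m)
  also have "\<dots> = (\<Sum>q\<in>Q. c q * (Y l m (x q) / (D l)\<^sup>2))"
    by (intro sum.cong refl) (simp add: hat_green[OF x m])
  finally show ?thesis by (simp add: sum_divide_distrib)
qed

text \<open>
  Cauchy-Schwarz over the points reduces the Sobolev norm to the series of \<open>(2 l + 1) / D\<^sub>l\<^sup>2\<close>.
\<close>

lemma potential_sobolev:
  assumes Q: "finite Q" and x: "\<And>q. q \<in> Q \<Longrightarrow> x q \<in> S2"
  shows "potential Q x c \<in> sobolev_cont Y p"
proof -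
  obtain d where d: "d > 0" "\<And>l. (1 + real l) powr (2 * p) \<le> d * (D l)\<^sup>2"
    using admissible_square_bounds[OF D] by metis
  let ?w = "\<lambda>l. (1 + real l * (real l + 1)) powr p"
  let ?A = "\<lambda>l. \<Sum>m\<in>orders l. (hat (potential Q x c) l m)\<^sup>2"
  define C where "C = (\<Sum>q\<in>Q. (c q)\<^sup>2)"
  have "summable (\<lambda>l. ?w l * ?A l)"
  proof (rule summable_comparison_test'[where N = 0])
    show "summable (\<lambda>l. d * C * real (card Q) / area * ((2 * real l + 1) / (D l)\<^sup>2))"
      by (rule summable_mult[OF summable_dimension_over_square[OF p D]])
    fix l
    have "(\<Sum>m\<in>orders l. (\<Sum>q\<in>Q. c q * Y l m (x q))\<^sup>2) \<le> (\<Sum>m\<in>orders l. C * (\<Sum>q\<in>Q. (Y l m (x q))\<^sup>2))"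
      unfolding C_def by (intro sum_mono Cauchy_Schwarz_ineq_sum)
    also have "\<dots> = C * (\<Sum>q\<in>Q. degree_kernel l (x q) (x q))"
      unfolding degree_kernel_def sum_distrib_left[symmetric]
      by (subst sum.swap) (simp add: power2_eq_square)
    also have "(\<Sum>q\<in>Q. degree_kernel l (x q) (x q)) = (\<Sum>q\<in>Q. (2 * real l + 1) / area)"
      by (intro sum.cong refl degree_kernel_diagonal' x)
    finally have b: "(\<Sum>m\<in>orders l. (\<Sum>q\<in>Q. c q * Y l m (x q))\<^sup>2) \<le> C * (real (card Q) * ((2 * real l + 1) / area))"
      by simp
    have "?A l = (\<Sum>m\<in>orders l. (\<Sum>q\<in>Q. c q * Y l m (x q))\<^sup>2) / ((D l)\<^sup>2)\<^sup>2"
      unfolding sum_divide_distrib[of _ "orders l"]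
      by (intro sum.cong refl) (simp only: hat_potential[OF x] power_divide)
    also have "\<dots> \<le> C * (real (card Q) * ((2 * real l + 1) / area)) / ((D l)\<^sup>2)\<^sup>2"
      by (intro divide_right_mono b) simp
    finally have A: "?A l \<le> C * (real (card Q) * ((2 * real l + 1) / area)) / ((D l)\<^sup>2)\<^sup>2" .
    have w: "?w l \<le> d * (D l)\<^sup>2"
      using sobolev_weight_bounds(2)[of p l] p d(2)[of l] by linarith
    have "?w l * ?A l \<le> (d * (D l)\<^sup>2) * (C * (real (card Q) * ((2 * real l + 1) / area)) / ((D l)\<^sup>2)\<^sup>2)"
      using d by (intro mult_mono w A) (auto simp: sum_nonneg)
    also have "\<dots> = d * C * real (card Q) / area * ((2 * real l + 1) / (D l)\<^sup>2)"
      using D_nonzero[of l] area_pos by (simp add: field_simps power2_eq_square)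
    finally show "norm (?w l * ?A l) \<le> d * C * real (card Q) / area * ((2 * real l + 1) / (D l)\<^sup>2)"
      by (simp add: sum_nonneg)
  qed
  then show ?thesis
    using potential_continuous[OF x] square_integrable_continuous[OF potential_continuous[OF x]]
    by (auto simp: sobolev_cont_def sobolev_def potential_def)
qed

text \<open>
  The identity \<open>\<parallel>D (f - \<mu>)\<parallel>\<^sup>2 = \<parallel>D f\<parallel>\<^sup>2 - \<parallel>D \<mu>\<parallel>\<^sup>2 - 2 \<langle>\<mu>, f - \<mu>\<rangle>\<close>, read degree by degree. The
  reproducing property turns the last term into point values: \<open>D\<^sub>l\<^sup>2\<close> times a coefficient of \<open>\<mu>\<close> is
  \<open>\<Sum>\<^sub>q c\<^sub>q Y\<^sub>l\<^sub>m(x\<^sub>q)\<close>, so the pairing with \<open>f - \<mu>\<close> is the Fourier series of \<open>f - \<mu>\<close> at the points.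
\<close>

lemma sph_op_norm_expansion:
  fixes x :: "'q \<Rightarrow> real^3" and c :: "'q \<Rightarrow> real"
  assumes Q: "finite Q" and x: "\<And>q. q \<in> Q \<Longrightarrow> x q \<in> S2" and f: "f \<in> sobolev_cont Y p"
  defines "\<mu> \<equiv> potential Q x c"
  shows "(\<lambda>l. \<Sum>m\<in>orders l. (D l * (hat f l m - hat \<mu> l m))\<^sup>2) sums
    ((l2_norm (sph_op Y D f))\<^sup>2 - (l2_norm (sph_op Y D \<mu>))\<^sup>2 - 2 * (\<Sum>q\<in>Q. c q * (f (x q) - \<mu> (x q))))"
proof -
  have \<mu>: "\<mu> \<in> sobolev_cont Y p"
    unfolding \<mu>_def by (rule potential_sobolev[OF Q x])
  have fs: "f \<in> sobolev Y p" "\<mu> \<in> sobolev Y p"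
    using f \<mu> by (auto simp: sobolev_cont_def)
  have cross: "(\<lambda>l. \<Sum>q\<in>Q. c q * (degree_part (hat f) l (x q) - degree_part (hat \<mu>) l (x q))) sums
      (\<Sum>q\<in>Q. c q * (f (x q) - \<mu> (x q)))"
    by (intro sums_sum sums_mult sums_diff sobolev_pointwise[OF p] f \<mu> x)
  have cross_coeff: "(\<Sum>q\<in>Q. c q * (degree_part (hat f) l (x q) - degree_part (hat \<mu>) l (x q))) =
      (\<Sum>m\<in>orders l. (D l)\<^sup>2 * hat \<mu> l m * (hat f l m - hat \<mu> l m))" for l
  proof -
    have "(\<Sum>q\<in>Q. c q * (degree_part (hat f) l (x q) - degree_part (hat \<mu>) l (x q))) =
        (\<Sum>q\<in>Q. \<Sum>m\<in>orders l. c q * Y l m (x q) * (hat f l m - hat \<mu> l m))"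
      by (simp add: degree_part_def sum_distrib_left algebra_simps flip: sum_subtractf)
    also have "\<dots> = (\<Sum>m\<in>orders l. \<Sum>q\<in>Q. c q * Y l m (x q) * (hat f l m - hat \<mu> l m))"
      by (rule sum.swap)
    also have "\<dots> = (\<Sum>m\<in>orders l. (D l)\<^sup>2 * hat \<mu> l m * (hat f l m - hat \<mu> l m))"
    proof (rule sum.cong[OF refl])
      fix m assume m: "m \<in> orders l"
      have "(D l)\<^sup>2 * hat \<mu> l m = (\<Sum>q\<in>Q. c q * Y l m (x q))"
        using D_nonzero[of l] by (simp add: \<mu>_def hat_potential[OF x m])
      then show "(\<Sum>q\<in>Q. c q * Y l m (x q) * (hat f l m - hat \<mu> l m)) =
          (D l)\<^sup>2 * hat \<mu> l m * (hat f l m - hat \<mu> l m)"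
        by (simp add: sum_distrib_right)
    qed
    finally show ?thesis .
  qed
  have "(\<lambda>l. (\<Sum>m\<in>orders l. (D l * hat f l m)\<^sup>2) - (\<Sum>m\<in>orders l. (D l * hat \<mu> l m)\<^sup>2)
        - 2 * (\<Sum>q\<in>Q. c q * (degree_part (hat f) l (x q) - degree_part (hat \<mu>) l (x q)))) sums
      ((l2_norm (sph_op Y D f))\<^sup>2 - (l2_norm (sph_op Y D \<mu>))\<^sup>2 - 2 * (\<Sum>q\<in>Q. c q * (f (x q) - \<mu> (x q))))"
    by (intro sums_diff sums_mult cross sobolev_sph_op_norm_sums[OF D] fs)
  moreover have "(\<Sum>m\<in>orders l. (D l * hat f l m)\<^sup>2) - (\<Sum>m\<in>orders l. (D l * hat \<mu> l m)\<^sup>2)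
        - 2 * (\<Sum>q\<in>Q. c q * (degree_part (hat f) l (x q) - degree_part (hat \<mu>) l (x q))) =
      (\<Sum>m\<in>orders l. (D l * (hat f l m - hat \<mu> l m))\<^sup>2)" for l
    unfolding cross_coeff sum_distrib_left sum_subtractf[symmetric]
    by (rule sum.cong) (auto simp: power2_eq_square algebra_simps)
  ultimately show ?thesis by simp
qed

text \<open>
  Completing the square around \<open>\<mu>\<close>. The stationarity condition makes the derivative of the objective
  at \<open>\<mu>\<close> vanish, so that all terms linear in \<open>f - \<mu>\<close> cancel. Weighted data terms are allowed so that
  the normalising factors of the application can be absorbed in \<open>\<omega>\<close>.
\<close>

lemma is_arg_min_iff_potential:
  fixes x :: "'q \<Rightarrow> real^3" and c \<omega> y :: "'q \<Rightarrow> real" and \<eta> :: real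
  assumes Q: "finite Q" and x: "\<And>q. q \<in> Q \<Longrightarrow> x q \<in> S2"
    and \<eta>: "\<eta> > 0" and \<omega>: "\<And>q. q \<in> Q \<Longrightarrow> \<omega> q \<ge> 0"
  defines "J \<equiv> \<lambda>f. (\<Sum>q\<in>Q. \<omega> q * (y q - f (x q))\<^sup>2) + \<eta> * (l2_norm (sph_op Y D f))\<^sup>2"
    and "\<mu> \<equiv> potential Q x c"
  assumes stationary: "\<And>q. q \<in> Q \<Longrightarrow> \<eta> * c q = \<omega> q * (y q - \<mu> (x q))"
  shows "is_arg_min J (\<lambda>f. f \<in> sobolev_cont Y p) f \<longleftrightarrow> f = \<mu>"
proof -
  have \<mu>: "\<mu> \<in> sobolev_cont Y p"
    unfolding \<mu>_def by (rule potential_sobolev[OF Q x])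
  define R where "R f = (l2_norm (sph_op Y D f))\<^sup>2 - (l2_norm (sph_op Y D \<mu>))\<^sup>2
      - 2 * (\<Sum>q\<in>Q. c q * (f (x q) - \<mu> (x q)))" for f
  have R: "(\<lambda>l. \<Sum>m\<in>orders l. (D l * (hat f l m - hat \<mu> l m))\<^sup>2) sums R f" if "f \<in> sobolev_cont Y p" for f
    unfolding R_def \<mu>_def by (rule sph_op_norm_expansion[OF Q x that])
  have R0: "R f \<ge> 0" if "f \<in> sobolev_cont Y p" for f
    by (rule sums_le[OF _ sums_zero R[OF that]]) (simp add: sum_nonneg)
  have J: "J f = J \<mu> + (\<Sum>q\<in>Q. \<omega> q * (f (x q) - \<mu> (x q))\<^sup>2) + \<eta> * R f" for f
  proof -
    have "\<eta> * (2 * (\<Sum>q\<in>Q. c q * (f (x q) - \<mu> (x q)))) = (\<Sum>q\<in>Q. 2 * (\<eta> * c q) * (f (x q) - \<mu> (x q)))"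
      by (simp add: sum_distrib_left mult_ac)
    also have "\<dots> = (\<Sum>q\<in>Q. 2 * (\<omega> q * (y q - \<mu> (x q))) * (f (x q) - \<mu> (x q)))"
      by (intro sum.cong refl) (simp add: stationary)
    also have "\<dots> = (\<Sum>q\<in>Q. \<omega> q * (f (x q) - \<mu> (x q))\<^sup>2) + (\<Sum>q\<in>Q. \<omega> q * (y q - \<mu> (x q))\<^sup>2)
        - (\<Sum>q\<in>Q. \<omega> q * (y q - f (x q))\<^sup>2)"
      unfolding sum.distrib[symmetric] sum_subtractf[symmetric]
      by (intro sum.cong refl) (simp add: power2_eq_square algebra_simps)
    finally show ?thesis
      unfolding J_def R_def by (simp add: right_diff_distrib)
  qed
  have nn: "0 \<le> (\<Sum>q\<in>Q. \<omega> q * (f (x q) - \<mu> (x q))\<^sup>2)" for f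
    by (intro sum_nonneg mult_nonneg_nonneg \<omega>) auto
  have ge: "J \<mu> \<le> J f" if "f \<in> sobolev_cont Y p" for f
    using J[of f] nn[of f] R0[OF that] \<eta> by (simp add: mult_nonneg_nonneg)
  have uniq: "f = \<mu>" if f: "f \<in> sobolev_cont Y p" and le: "J f \<le> J \<mu>" for f
  proof -
    have "\<eta> * R f \<le> 0"
      using J[of f] nn[of f] le by linarith
    then have "R f = 0"
      using R0[OF f] \<eta> by (simp add: mult_le_0_iff)
    then have s0: "(\<lambda>l. \<Sum>m\<in>orders l. (D l * (hat f l m - hat \<mu> l m))\<^sup>2) sums 0"
      using R[OF f] by simp
    have z: "(\<Sum>m\<in>orders l. (D l * (hat f l m - hat \<mu> l m))\<^sup>2) = 0" for l
    proof -
      have "\<forall>l. (\<Sum>m\<in>orders l. (D l * (hat f l m - hat \<mu> l m))\<^sup>2) = 0"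
        using suminf_eq_zero_iff[OF sums_summable[OF s0]] sums_unique[OF s0] by (simp add: sum_nonneg)
      then show ?thesis by blast
    qed
    have c: "continuous_on S2 f" "continuous_on S2 \<mu>" and e: "f \<in> extensional S2" "\<mu> \<in> extensional S2"
      using f \<mu> by (auto simp: sobolev_cont_def)
    have "f v - \<mu> v = 0" if "v \<in> S2" for v
    proof (rule zero_if_coefficients_zero[OF _ _ that, where f = "\<lambda>v. f v - \<mu> v"])
      show "continuous_on S2 (\<lambda>v. f v - \<mu> v)"
        by (intro continuous_intros c)
      fix l m assume m: "m \<in> orders l"
      then have "(D l * (hat f l m - hat \<mu> l m))\<^sup>2 = 0"
        using z[of l] by (subst (asm) sum_nonneg_eq_0_iff) auto
      then show "l2_inner (\<lambda>v. f v - \<mu> v) (Y l m) = 0"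
        using D_nonzero[of l] by (simp add: l2_inner_diff[OF c Y_continuous[OF m]])
    qed
    then show ?thesis
      using e by (intro extensionalityI[of _ S2]) auto
  qed
  show ?thesis
    unfolding is_arg_min_def using \<mu> ge uniq by (metis not_le)
qed

end

end

section \<open>The linear system\<close>

lemma shifted_gram_mult_vec:
  fixes g :: "nat \<Rightarrow> nat \<Rightarrow> real"
  assumes "v \<in> carrier_vec L" "i < L"
  shows "((mat L L (\<lambda>(i, j). g i j) + c \<cdot>\<^sub>m 1\<^sub>m L) *\<^sub>v v) $ i = (\<Sum>j<L. g i j * v $ j) + c * v $ i"
proof -
  have "((mat L L (\<lambda>(i, j). g i j) + c \<cdot>\<^sub>m 1\<^sub>m L) *\<^sub>v v) $ i =
      (\<Sum>j<L. (g i j + (if j = i then c else 0)) * v $ j)"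
    using assms by (simp add: scalar_prod_def lessThan_atLeast0 if_distrib[of "(*) c"] cong: if_cong)
  also have "\<dots> = (\<Sum>j<L. g i j * v $ j) + (\<Sum>j<L. if j = i then c * v $ j else 0)"
    unfolding sum.distrib[symmetric] by (intro sum.cong) (auto simp: distrib_right)
  finally show ?thesis using assms(2) by simp
qed

text \<open>
  A vector \<open>v\<close> in the kernel satisfies \<open>0 = v\<^sup>T M v \<ge> c \<parallel>v\<parallel>\<^sup>2\<close>.
\<close>

lemma shifted_gram_invertible:
  fixes g :: "nat \<Rightarrow> nat \<Rightarrow> real"
  assumes g: "\<And>v. 0 \<le> (\<Sum>i<L. \<Sum>j<L. v i * v j * g i j)" and c: "c > 0"
  defines "M \<equiv> mat L L (\<lambda>(i, j). g i j) + c \<cdot>\<^sub>m 1\<^sub>m L"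
  obtains B where "B \<in> carrier_mat L L" "inverts_mat M B" "inverts_mat B M"
proof -
  have M: "M \<in> carrier_mat L L" by (simp add: M_def)
  have "det M \<noteq> 0"
  proof
    assume "det M = 0"
    then obtain v where v: "v \<in> carrier_vec L" "v \<noteq> 0\<^sub>v L" "M *\<^sub>v v = 0\<^sub>v L"
      using det_0_iff_vec_prod_zero_field[OF M] by blast
    have row: "(\<Sum>j<L. g i j * v $ j) + c * v $ i = 0" if "i < L" for i
    proof -
      have "(M *\<^sub>v v) $ i = (\<Sum>j<L. g i j * v $ j) + c * v $ i"
        unfolding M_def by (rule shifted_gram_mult_vec[OF v(1) that])
      then show ?thesis using that v(3) by simp
    qed
    have "0 = (\<Sum>i<L. v $ i * ((\<Sum>j<L. g i j * v $ j) + c * v $ i))"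
      by (simp add: row)
    also have "\<dots> = (\<Sum>i<L. \<Sum>j<L. v $ i * v $ j * g i j) + c * (\<Sum>i<L. (v $ i)\<^sup>2)"
      by (simp add: distrib_left sum.distrib sum_distrib_left power2_eq_square mult_ac)
    finally have "c * (\<Sum>i<L. (v $ i)\<^sup>2) \<le> 0"
      using g[of "\<lambda>i. v $ i"] by linarith
    then have "(\<Sum>i<L. (v $ i)\<^sup>2) \<le> 0"
      using c by (simp add: mult_le_0_iff)
    then have "(\<Sum>i<L. (v $ i)\<^sup>2) = 0"
      using sum_nonneg[of "{..<L}" "\<lambda>i. (v $ i)\<^sup>2"] by simp
    then have "v $ i = 0" if "i < L" for i
      using that by (subst (asm) sum_nonneg_eq_0_iff) auto
    then have "v = 0\<^sub>v L"
      using v(1) by (intro eq_vecI) auto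
    then show False using v(2) by simp
  qed
  from det_non_zero_imp_unit[OF M this, of "()"]
  obtain B where "B \<in> carrier_mat L L" "B * M = 1\<^sub>m L" "M * B = 1\<^sub>m L"
    by (auto simp: Units_def ring_mat_def)
  then show ?thesis
    using that M by (auto simp: inverts_mat_def)
qed

text \<open>
  The system is indexed by a set, so that one solution \<open>h\<close> serves all enumerations of the set at once: it is
  computed with an arbitrary enumeration, and in every other one the matrix form follows from the system.
\<close>

lemma regularised_interpolation_system:
  fixes G :: "'q \<Rightarrow> 'q \<Rightarrow> real"
  assumes Q: "finite Q"
    and nonneg: "\<And>v. 0 \<le> (\<Sum>q\<in>Q. \<Sum>q'\<in>Q. v q * v q' * G q q')" and c: "c > 0"
  obtains h where "\<And>q. q \<in> Q \<Longrightarrow> (\<Sum>q'\<in>Q. G q q' * h q') + c * h q = y q"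
    "\<And>L e. bij_betw e {..<L} Q \<Longrightarrow>
      \<exists>B\<in>carrier_mat L L.
        inverts_mat (mat L L (\<lambda>(k1, k2). G (e k1) (e k2)) + c \<cdot>\<^sub>m 1\<^sub>m L) B \<and>
        inverts_mat B (mat L L (\<lambda>(k1, k2). G (e k1) (e k2)) + c \<cdot>\<^sub>m 1\<^sub>m L) \<and>
        vec L (\<lambda>k. h (e k)) = B *\<^sub>v vec L (\<lambda>k. y (e k))"
proof -
  let ?M = "\<lambda>L e. mat L L (\<lambda>(k1, k2). G (e k1) (e k2)) + c \<cdot>\<^sub>m 1\<^sub>m L"
  have inv: "\<exists>B\<in>carrier_mat L L. inverts_mat (?M L e) B \<and> inverts_mat B (?M L e)"
    if e: "bij_betw e {..<L} Q" for L e
  proof -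
    have nn: "0 \<le> (\<Sum>i<L. \<Sum>j<L. v i * v j * G (e i) (e j))" for v
    proof -
      have inv_e: "the_inv_into {..<L} e (e i) = i" if "i < L" for i
        using that e by (intro the_inv_into_f_f) (auto simp: bij_betw_def)
      have "0 \<le> (\<Sum>q\<in>Q. \<Sum>q'\<in>Q. v (the_inv_into {..<L} e q) * v (the_inv_into {..<L} e q') * G q q')"
        by (rule nonneg)
      also have "\<dots> = (\<Sum>i<L. \<Sum>j<L. v i * v j * G (e i) (e j))"
        unfolding sum.reindex_bij_betw[OF e, symmetric]
        by (intro sum.cong refl) (simp add: inv_e)
      finally show ?thesis .
    qed
    obtain B where "B \<in> carrier_mat L L" "inverts_mat (?M L e) B" "inverts_mat B (?M L e)"
      by (rule shifted_gram_invertible[OF nn c])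
    then show ?thesis by blast
  qed
  obtain e0 where e0: "bij_betw e0 {..<card Q} Q"
    using ex_bij_betw_nat_finite[OF Q] by (auto simp: lessThan_atLeast0)
  obtain B0 where B0: "B0 \<in> carrier_mat (card Q) (card Q)" "inverts_mat (?M (card Q) e0) B0"
    using inv[OF e0] by blast
  define h where "h q = (B0 *\<^sub>v vec (card Q) (\<lambda>k. y (e0 k))) $ the_inv_into {..<card Q} e0 q" for q
  have he0: "h (e0 k) = (B0 *\<^sub>v vec (card Q) (\<lambda>k. y (e0 k))) $ k" if "k < card Q" for k
    using that e0 by (simp add: h_def the_inv_into_f_f bij_betw_def)
  have sys: "(\<Sum>q'\<in>Q. G q q' * h q') + c * h q = y q" if "q \<in> Q" for q
  proof -
    obtain i where i: "i < card Q" "q = e0 i"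
      using e0 \<open>q \<in> Q\<close> by (auto simp: bij_betw_def)
    let ?y = "vec (card Q) (\<lambda>k. y (e0 k))"
    have "?M (card Q) e0 *\<^sub>v (B0 *\<^sub>v ?y) = (?M (card Q) e0 * B0) *\<^sub>v ?y"
      by (rule assoc_mult_mat_vec[symmetric]) (use B0 in auto)
    also have "\<dots> = ?y"
      using B0(2) by (simp add: inverts_mat_def)
    finally have "(?M (card Q) e0 *\<^sub>v (B0 *\<^sub>v ?y)) $ i = y (e0 i)"
      using i by simp
    moreover have "(?M (card Q) e0 *\<^sub>v (B0 *\<^sub>v ?y)) $ i =
        (\<Sum>j<card Q. G (e0 i) (e0 j) * (B0 *\<^sub>v ?y) $ j) + c * (B0 *\<^sub>v ?y) $ i"
      by (rule shifted_gram_mult_vec[where g = "\<lambda>i j. G (e0 i) (e0 j)"]) (use B0(1) i in auto)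
    ultimately show ?thesis
      unfolding sum.reindex_bij_betw[OF e0, symmetric] i(2) using i(1) by (simp add: he0)
  qed
  show ?thesis
  proof (rule that[OF sys])
    fix L :: nat and e assume e: "bij_betw e {..<L} Q"
    obtain B where B: "B \<in> carrier_mat L L" "inverts_mat (?M L e) B" "inverts_mat B (?M L e)"
      using inv[OF e] by blast
    have eQ: "e k \<in> Q" if "k < L" for k
      using e that by (auto simp: bij_betw_def)
    have "?M L e *\<^sub>v vec L (\<lambda>k. h (e k)) = vec L (\<lambda>k. y (e k))"
    proof (rule eq_vecI)
      fix i assume "i < dim_vec (vec L (\<lambda>k. y (e k)))"
      then have i: "i < L" by simp
      have "(?M L e *\<^sub>v vec L (\<lambda>k. h (e k))) $ i =
          (\<Sum>j<L. G (e i) (e j) * vec L (\<lambda>k. h (e k)) $ j) + c * vec L (\<lambda>k. h (e k)) $ i"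
        by (rule shifted_gram_mult_vec[where g = "\<lambda>i j. G (e i) (e j)"]) (use i in auto)
      also have "\<dots> = (\<Sum>j<L. G (e i) (e j) * h (e j)) + c * h (e i)"
        using i by simp
      also have "\<dots> = y (e i)"
        using sys[OF eQ[OF i]] by (simp add: sum.reindex_bij_betw[OF e, symmetric])
      finally show "(?M L e *\<^sub>v vec L (\<lambda>k. h (e k))) $ i = vec L (\<lambda>k. y (e k)) $ i"
        using i by simp
    qed simp
    then have "B *\<^sub>v vec L (\<lambda>k. y (e k)) = B *\<^sub>v (?M L e *\<^sub>v vec L (\<lambda>k. h (e k)))"
      by simp
    also have "\<dots> = (B * ?M L e) *\<^sub>v vec L (\<lambda>k. h (e k))"
      by (rule assoc_mult_mat_vec[symmetric]) (use B in auto)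
    also have "\<dots> = vec L (\<lambda>k. h (e k))"
      using B by (simp add: inverts_mat_def)
    finally show "\<exists>B\<in>carrier_mat L L. inverts_mat (?M L e) B \<and> inverts_mat B (?M L e) \<and>
        vec L (\<lambda>k. h (e k)) = B *\<^sub>v vec L (\<lambda>k. y (e k))"
      using B by (intro bexI[of _ B]) auto
  qed
qed

text \<open>
  The general lemmas apply with the index pairs as the set of nodes, the factors \<open>s = 1 / \<surd>r\<^sub>i\<close>, the charges
  \<open>c = s h\<close> for the solution \<open>h\<close> of the symmetrically scaled system, and the weights
  \<open>\<omega> = 4 \<pi> / (n r\<^sub>i)\<close>. Multiplying an equation of that system by \<open>4 \<pi> s / n\<close> gives the stationarity
  condition.
\<close>

theorem theorem8:
  fixes Y :: sph_family and D :: "nat \<Rightarrow> real" and p \<eta> :: real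
    and n :: nat and r :: "nat \<Rightarrow> nat"
    and w :: "nat \<Rightarrow> nat \<Rightarrow> real" and u :: "nat \<Rightarrow> nat \<Rightarrow> real^3"
  assumes "spherical_harmonic_basis Y"
    and "p > 1" and "admissible p D"
    and "n \<ge> 1" and "\<forall>i\<in>{1..n}. r i \<ge> 1"
    and "\<forall>i\<in>{1..n}. \<forall>j\<in>{1..r i}. u i j \<in> S2"
    and "inj_on (\<lambda>(i, j). u i j) (SIGMA i:{1..n}. {1..r i})"
    and "\<eta> > 0"
  shows
    "let \<psi> = zonal_green_kernel Y (\<lambda>l. (D l)\<^sup>2);
         J = (\<lambda>f. 4 * pi / real n *
                    (\<Sum>i=1..n. 1 / real (r i) * (\<Sum>j=1..r i. (w i j - f (u i j))\<^sup>2))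
                  + \<eta> * (l2_norm (sph_op Y D f))\<^sup>2);
         L = (\<Sum>i=1..n. r i)
     in \<exists>\<mu> \<alpha>.
          (\<forall>f. is_arg_min J (\<lambda>f. f \<in> sobolev_cont Y p) f \<longleftrightarrow> f = \<mu>) \<and>
          \<mu> = (\<lambda>v\<in>S2. \<Sum>i=1..n. 1 / sqrt (real (r i)) * (\<Sum>j=1..r i. \<alpha> i j * \<psi> (v \<bullet> u i j))) \<and>
          (\<forall>e. bij_betw e {..<L} (SIGMA i:{1..n}. {1..r i}) \<longrightarrow>
            (let y = vec L (\<lambda>k. case e k of (i, j) \<Rightarrow> w i j / sqrt (real (r i)));
                 G = mat L L (\<lambda>(k1, k2). case (e k1, e k2) of ((i1, j1), (i2, j2)) \<Rightarrow>
                       \<psi> (u i1 j1 \<bullet> u i2 j2) / sqrt (real (r i1) * real (r i2)));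
                 M = G + (\<eta> * real n / (4 * pi)) \<cdot>\<^sub>m 1\<^sub>m L
             in \<exists>B \<in> carrier_mat L L. inverts_mat M B \<and> inverts_mat B M \<and>
                  vec L (\<lambda>k. case e k of (i, j) \<Rightarrow> \<alpha> i j) = B *\<^sub>v y))"
proof -
  interpret spherical_basis Y by unfold_locales fact
  note p = assms(2) and D = assms(3)
  define Q where "Q = (SIGMA i:{1..n}. {1..r i})"
  define x where "x = (\<lambda>(i, j). u i j)"
  define s where "s q = 1 / sqrt (real (r (fst q)))" for q :: "nat \<times> nat"
  define \<kappa> where "\<kappa> = 4 * pi / real n"
  let ?\<psi> = "zonal_green_kernel Y (\<lambda>l. (D l)\<^sup>2)"
  define G where "G = (\<lambda>q q'. case (q, q') of ((i1, j1), (i2, j2)) \<Rightarrow>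
      ?\<psi> (u i1 j1 \<bullet> u i2 j2) / sqrt (real (r i1) * real (r i2)))"
  define y where "y = (\<lambda>(i, j). w i j / sqrt (real (r i)))"
  have Q: "finite Q" by (simp add: Q_def)
  have sum_Q: "(\<Sum>q\<in>Q. F q) = (\<Sum>i=1..n. \<Sum>j=1..r i. F (i, j))" for F :: "nat \<times> nat \<Rightarrow> real"
    unfolding Q_def by (subst sum.Sigma) auto
  have xS: "x q \<in> S2" if "q \<in> Q" for q
    using that assms(6) by (auto simp: Q_def x_def)
  have \<kappa>: "\<kappa> > 0" using assms(4) by (simp add: \<kappa>_def)
  have s2: "s q * s q = 1 / real (r (fst q))" for q
    by (simp add: s_def)
  have G_eq: "G q q' = s q * s q' * ?\<psi> (inner (x q) (x q'))" for q q'
    by (auto simp: G_def s_def x_def real_sqrt_mult split: prod.split)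
  have psd: "0 \<le> (\<Sum>q\<in>Q. \<Sum>q'\<in>Q. v q * v q' * G q q')" for v
    using gram_nonneg[OF p D Q xS, where c = "\<lambda>q. v q * s q"] by (simp add: G_eq mult_ac)
  have c0: "\<eta> * real n / (4 * pi) > 0"
    using assms(4,8) by simp
  obtain h where h: "\<And>q. q \<in> Q \<Longrightarrow> (\<Sum>q'\<in>Q. G q q' * h q') + \<eta> * real n / (4 * pi) * h q = y q"
    and he: "\<And>L e. bij_betw e {..<L} Q \<Longrightarrow>
      \<exists>B\<in>carrier_mat L L.
        inverts_mat (mat L L (\<lambda>(k1, k2). G (e k1) (e k2)) + (\<eta> * real n / (4 * pi)) \<cdot>\<^sub>m 1\<^sub>m L) B \<and>
        inverts_mat B (mat L L (\<lambda>(k1, k2). G (e k1) (e k2)) + (\<eta> * real n / (4 * pi)) \<cdot>\<^sub>m 1\<^sub>m L) \<and>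
        vec L (\<lambda>k. h (e k)) = B *\<^sub>v vec L (\<lambda>k. y (e k))"
    using regularised_interpolation_system[OF Q psd c0, where y = y] by blast
  define c where "c q = s q * h q" for q
  define \<mu> where "\<mu> = potential D Q x c"
  define J where "J = (\<lambda>f. 4 * pi / real n *
      (\<Sum>i=1..n. 1 / real (r i) * (\<Sum>j=1..r i. (w i j - f (u i j))\<^sup>2)) + \<eta> * (l2_norm (sph_op Y D f))\<^sup>2)"
  have J_eq: "J = (\<lambda>f. (\<Sum>q\<in>Q. (\<kappa> * (s q * s q)) * ((\<lambda>(i, j). w i j) q - f (x q))\<^sup>2) + \<eta> * (l2_norm (sph_op Y D f))\<^sup>2)"
    unfolding J_def s2 sum_Q by (simp add: sum_distrib_left \<kappa>_def x_def)
  have stationary: "\<eta> * c q = (\<kappa> * (s q * s q)) * ((\<lambda>(i, j). w i j) q - \<mu> (x q))" if q: "q \<in> Q" for q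
  proof -
    have "s q * \<mu> (x q) = (\<Sum>q'\<in>Q. G q q' * h q')"
      using xS[OF q] by (simp add: \<mu>_def potential_def[OF p D] G_eq c_def sum_distrib_left mult_ac)
    then have "s q * \<mu> (x q) + \<eta> / \<kappa> * h q = y q"
      using h[OF q] by (simp add: \<kappa>_def)
    moreover have "y q = s q * (\<lambda>(i, j). w i j) q"
      by (simp add: y_def s_def case_prod_unfold)
    ultimately have key: "\<eta> / \<kappa> * h q = s q * (\<lambda>(i, j). w i j) q - s q * \<mu> (x q)"
      by linarith
    have "\<eta> * c q = \<kappa> * s q * (\<eta> / \<kappa> * h q)"
      using \<kappa> by (simp add: c_def)
    also have "\<dots> = (\<kappa> * (s q * s q)) * ((\<lambda>(i, j). w i j) q - \<mu> (x q))"
      unfolding key by (simp only: right_diff_distrib mult.assoc)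
    finally show ?thesis .
  qed
  have min: "is_arg_min J (\<lambda>f. f \<in> sobolev_cont Y p) f \<longleftrightarrow> f = \<mu>" for f
    unfolding J_eq \<mu>_def
    by (rule is_arg_min_iff_potential[OF p D Q xS assms(8)])
       (use \<kappa> stationary in \<open>auto simp: s2 \<mu>_def\<close>)
  have \<mu>_eq: "\<mu> = (\<lambda>v\<in>S2. \<Sum>i=1..n. 1 / sqrt (real (r i)) * (\<Sum>j=1..r i. h (i, j) * ?\<psi> (v \<bullet> u i j)))"
    unfolding \<mu>_def potential_def[OF p D] sum_Q c_def
    by (simp add: sum_distrib_left s_def x_def)
  show ?thesis
    unfolding Let_def J_def[symmetric]
  proof (rule exI[of _ \<mu>], rule exI[of _ "\<lambda>i j. h (i, j)"], intro conjI allI impI)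
    show "is_arg_min J (\<lambda>f. f \<in> sobolev_cont Y p) f \<longleftrightarrow> f = \<mu>" for f
      by (rule min)
    show "\<mu> = (\<lambda>v\<in>S2. \<Sum>i=1..n. 1 / sqrt (real (r i)) * (\<Sum>j=1..r i. h (i, j) * ?\<psi> (v \<bullet> u i j)))"
      by (rule \<mu>_eq)
    fix e assume "bij_betw e {..<\<Sum>i=1..n. r i} (SIGMA i:{1..n}. {1..r i})"
    from he[OF this[folded Q_def]]
    show "\<exists>B\<in>carrier_mat (\<Sum>i=1..n. r i) (\<Sum>i=1..n. r i).
       inverts_mat (mat (\<Sum>i=1..n. r i) (\<Sum>i=1..n. r i) (\<lambda>(k1, k2). case (e k1, e k2) of ((i1, j1), (i2, j2)) \<Rightarrow>
           ?\<psi> (u i1 j1 \<bullet> u i2 j2) / sqrt (real (r i1) * real (r i2))) +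
          (\<eta> * real n / (4 * pi)) \<cdot>\<^sub>m 1\<^sub>m (\<Sum>i=1..n. r i)) B \<and>
       inverts_mat B (mat (\<Sum>i=1..n. r i) (\<Sum>i=1..n. r i) (\<lambda>(k1, k2). case (e k1, e k2) of ((i1, j1), (i2, j2)) \<Rightarrow>
           ?\<psi> (u i1 j1 \<bullet> u i2 j2) / sqrt (real (r i1) * real (r i2))) +
          (\<eta> * real n / (4 * pi)) \<cdot>\<^sub>m 1\<^sub>m (\<Sum>i=1..n. r i)) \<and>
       vec (\<Sum>i=1..n. r i) (\<lambda>k. case e k of (i, j) \<Rightarrow> h (i, j)) =
         B *\<^sub>v vec (\<Sum>i=1..n. r i) (\<lambda>k. case e k of (i, j) \<Rightarrow> w i j / sqrt (real (r i)))"
      by (simp add: G_def y_def)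
  qed
qed

end
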